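(* Let $n\geq 6$ and consider the action of $\mathrm{Aut}(C_n)=D_n$ on $V(C_n)$ with $2$ colors. If $4\nmid n$ and $5\nmid n$, then $\mathrm{ext}_D(C_n)=4$. If $4\mid n$ and $5\nmid n$, then $\mathrm{ext}_D(C_n)=5$. If $5\mid n$, then $\mathrm{ext}_D(C_n)=6$. Moreover, for the action of $O(2)=\mathrm{Isom}(S^1)$ on the unit circle $S^1$ with $2$ colors, $\mathrm{ext}_D(S^1,O(2))=6$.
   Context: Let a group $\Gamma$ act faithfully on a set $X$. A coloring $c:X\to\{R,B\}$ is $\Gamma$-distinguishing if the only $\gamma\in\Gamma$ with $c\circ\gamma=c$ is the identity. For $W\subset X$ whose pointwise stabilizer in $\Gamma$ is trivial, the precoloring extension property $P(W)$ holds if every precoloring $c:X\setminus W\to\{R,B\}$ can be extended to a $\Gamma$-distinguishing coloring $X\to\{R,B\}$. The distinguishing extension number $\mathrm{ext}_D(X,\Gamma)$ is the smallest $m$ such that every $W\subset X$ with $|W|\geq m$ and trivial pointwise stabilizer in $\Gamma$ satisfies $P(W)$ (it is $\infty$ if no such $m$ exists). Here $C_n$ is the cycle graph on $n$ vertices, $\mathrm{ext}_D(C_n):=\mathrm{ext}_D(V(C_n),\mathrm{Aut}(C_n))$, and the number of colors is $2$ (the distinguishing number in all cases considered). *)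

theory Defs
  imports "HOL-Analysis.Analysis" "HOL-Library.Extended_Nat"
begin

text \<open>A group acting faithfully on X is represented by a set G of maps X to X
  (faithfulness is automatic). Colourings use two colours, encoded as bool
  (True = R, False = B).\<close>

definition distinguishing :: "'a set \<Rightarrow> ('a \<Rightarrow> 'a) set \<Rightarrow> ('a \<Rightarrow> bool) \<Rightarrow> bool" where
  "distinguishing X G c \<longleftrightarrow>
     (\<forall>g\<in>G. (\<forall>x\<in>X. c (g x) = c x) \<longrightarrow> (\<forall>x\<in>X. g x = x))"

definition trivial_pointwise_stab :: "'a set \<Rightarrow> ('a \<Rightarrow> 'a) set \<Rightarrow> 'a set \<Rightarrow> bool" where
  "trivial_pointwise_stab X G W \<longleftrightarrow>
     (\<forall>g\<in>G. (\<forall>w\<in>W. g w = w) \<longrightarrow> (\<forall>x\<in>X. g x = x))"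

definition precol_ext :: "'a set \<Rightarrow> ('a \<Rightarrow> 'a) set \<Rightarrow> 'a set \<Rightarrow> bool" where
  "precol_ext X G W \<longleftrightarrow>
     (\<forall>c0 :: 'a \<Rightarrow> bool. \<exists>c. (\<forall>x\<in>X - W. c x = c0 x) \<and> distinguishing X G c)"

definition ext_good :: "'a set \<Rightarrow> ('a \<Rightarrow> 'a) set \<Rightarrow> nat \<Rightarrow> bool" where
  "ext_good X G m \<longleftrightarrow>
     (\<forall>W. W \<subseteq> X \<longrightarrow> (infinite W \<or> m \<le> card W) \<longrightarrow> trivial_pointwise_stab X G W
          \<longrightarrow> precol_ext X G W)"

definition extD :: "'a set \<Rightarrow> ('a \<Rightarrow> 'a) set \<Rightarrow> enat" where
  "extD X G = Inf (enat ` {m. ext_good X G m})"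

definition cycle_adj :: "nat \<Rightarrow> nat \<Rightarrow> nat \<Rightarrow> bool" where
  "cycle_adj n i j \<longleftrightarrow> i \<noteq> j \<and> (j = Suc i mod n \<or> i = Suc j mod n)"

definition cycle_aut :: "nat \<Rightarrow> (nat \<Rightarrow> nat) set" where
  "cycle_aut n = {g. bij_betw g {0..<n} {0..<n} \<and>
      (\<forall>i\<in>{0..<n}. \<forall>j\<in>{0..<n}. cycle_adj n i j \<longleftrightarrow> cycle_adj n (g i) (g j))}"

definition extD_cycle :: "nat \<Rightarrow> enat" where
  "extD_cycle n = extD {0..<n} (cycle_aut n)"

definition circle :: "complex set" where
  "circle = sphere 0 1"

definition O2 :: "(complex \<Rightarrow> complex) set" where
  "O2 = {f. orthogonal_transformation f}"

end

theory Submission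
  imports Defs
begin

text \<open>
  Regard the circle as an abelian group; its isometries are the maps \<open>x \<mapsto> r + x\<close> and
  \<open>x \<mapsto> a - x\<close>, and the cycle on \<open>n\<close> vertices is the subgroup of \<open>n\<close>-th roots of unity.
  The key point is that \<open>P(W)\<close> holds as soon as \<open>W\<close> contains three points that do not form an
  arithmetic progression.  If all eight extensions of a precolouring to such a triple had a
  symmetry, then either some colouring is, up to one point, invariant under a rotation, and the
  coset structure of its stabilizer forces a progression, or the colour class \<open>S\<close> avoiding the
  triple has a unique axis; any two of the three points that are off the axis must be mirror images
  of each other, so the axis passes through two of the points.  The same axis then serves
  the complementary class and would have to fix all three points.

  So \<open>P(W)\<close> can only fail if all triples in \<open>W\<close> are progressions.  For \<open>|W| \<ge> 4\<close>
  this puts \<open>W\<close> into a regular 4-gon or a regular 5-gon, which bounds \<open>|W|\<close> by 4 or 5 and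
  forces \<open>4 dvd n\<close> or \<open>5 dvd n\<close>.  Conversely, every subset of a regular 4-gon, of a regular
  5-gon and of three consecutive vertices has an axis of symmetry.
\<close>

subsection \<open>Symmetric subsets of abelian groups\<close>

text \<open>The circle qualifies, with -1 as its only involution. Two halves of one element differ
  by an involution, so each element has at most two halves; equivalently, a reflection
  \<open>t \<mapsto> a - t\<close> fixes at most two points.\<close>

class unique_involution = ab_group_add +
  assumes unique_involution: "u + u = 0 \<Longrightarrow> v + v = 0 \<Longrightarrow> u \<noteq> 0 \<Longrightarrow> v \<noteq> 0 \<Longrightarrow> u = v"

lemma double_eq_triple:
  fixes x y z :: "'a::unique_involution"
  assumes "x + x = y + y" "x + x = z + z" "x \<noteq> y" "x \<noteq> z"
  shows "y = z"
proof -
  have "(x - y) + (x - y) = 0"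
    unfolding add_diff_add[symmetric] assms(1) by (rule diff_self)
  moreover have "(x - z) + (x - z) = 0"
    unfolding add_diff_add[symmetric] assms(2) by (rule diff_self)
  moreover have "x - y \<noteq> 0" "x - z \<noteq> 0" using assms(3,4) by simp_all
  ultimately have "x - y = x - z" by (rule unique_involution)
  then show ?thesis by simp
qed

definition rot_inv :: "'a::ab_group_add \<Rightarrow> 'a set \<Rightarrow> bool" where
  "rot_inv r S \<longleftrightarrow> (\<forall>t. t + r \<in> S \<longleftrightarrow> t \<in> S)"

definition refl_inv :: "'a::ab_group_add \<Rightarrow> 'a set \<Rightarrow> bool" where
  "refl_inv a S \<longleftrightarrow> (\<forall>t. a - t \<in> S \<longleftrightarrow> t \<in> S)"

text \<open>\<open>S\<close> stands for one colour class and \<open>sym_set S\<close> for a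
  colouring that is not distinguishing. A reflection of the circle is never the identity, so only
  the rotation by 0 is excluded.\<close>

definition sym_set :: "'a::ab_group_add set \<Rightarrow> bool" where
  "sym_set S \<longleftrightarrow> (\<exists>r. r \<noteq> 0 \<and> rot_inv r S) \<or> (\<exists>a. refl_inv a S)"

lemma sym_set_cases [consumes 1, case_names rot refl]:
  assumes "sym_set S"
  obtains r where "r \<noteq> 0" "rot_inv r S" | a where "refl_inv a S"
  using assms unfolding sym_set_def by blast

lemma rot_inv_Compl [simp]: "rot_inv r (- S) \<longleftrightarrow> rot_inv r S"
  and refl_inv_Compl [simp]: "refl_inv a (- S) \<longleftrightarrow> refl_inv a S"
  and sym_set_Compl [simp]: "sym_set (- S) \<longleftrightarrow> sym_set S"
  by (auto simp: rot_inv_def refl_inv_def sym_set_def)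

text \<open>The three points form an arithmetic progression in some order.\<close>

definition ap3 :: "'a::ab_group_add \<Rightarrow> 'a \<Rightarrow> 'a \<Rightarrow> bool" where
  "ap3 x y z \<longleftrightarrow> x + x = y + z \<or> y + y = x + z \<or> z + z = x + y"

lemma ap3_commute: "ap3 x y z = ap3 y x z" "ap3 x y z = ap3 x z y"
  unfolding ap3_def by (metis add.commute)+

section \<open>Algebra of periods and axes\<close>

lemma rot_inv_minus:
  assumes "rot_inv r S"
  shows "rot_inv (- r) S"
proof -
  have "t - r + r \<in> S \<longleftrightarrow> t - r \<in> S" for t
    using assms unfolding rot_inv_def by blast
  then show ?thesis by (simp add: rot_inv_def)
qed

lemma rot_inv_add: "rot_inv r S \<Longrightarrow> rot_inv s S \<Longrightarrow> rot_inv (r + s) S"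
  by (simp add: rot_inv_def add.assoc[symmetric])

lemma rot_inv_diff: "rot_inv r S \<Longrightarrow> rot_inv s S \<Longrightarrow> rot_inv (r - s) S"
  using rot_inv_add[of r S "- s"] rot_inv_minus[of s S] by simp

lemma rot_inv_zero [simp]: "rot_inv 0 S" by (simp add: rot_inv_def)

lemma rot_invD:
  assumes "rot_inv (s - t) P"
  shows "s \<in> P \<longleftrightarrow> t \<in> P"
proof -
  have "t + (s - t) \<in> P \<longleftrightarrow> t \<in> P"
    using assms unfolding rot_inv_def by blast
  then show ?thesis by simp
qed

lemma refl_inv_diff:
  assumes "refl_inv a S" "refl_inv b S"
  shows "rot_inv (a - b) S"
  unfolding rot_inv_def
proof
  fix t
  have "t + (a - b) = a - (b - t)" by (simp add: algebra_simps)
  then show "(t + (a - b) \<in> S) = (t \<in> S)"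
    using assms unfolding refl_inv_def by metis
qed

text \<open>A rotation acts on the three points as a 3-cycle, so they have common difference
  \<open>r\<close>. A reflection cannot fix all three, so it fixes one and swaps the other two,
  whose midpoint is then the fixed one.\<close>

lemma sym3_imp_ap3:
  fixes x y z :: "'a::unique_involution"
  assumes "sym_set {x, y, z}" "x \<noteq> y" "x \<noteq> z" "y \<noteq> z"
  shows "ap3 x y z"
  using assms(1)
proof (cases rule: sym_set_cases)
  case (rot r)
  have "x + r \<in> {x,y,z}" "y + r \<in> {x,y,z}" "z + r \<in> {x,y,z}"
    using rot(2) unfolding rot_inv_def by blast+
  then have "y = x + r \<or> z = x + r" "x = y + r \<or> z = y + r" "x = z + r \<or> y = z + r"
    using rot(1) by auto
  then have "(y = x + r \<and> z = y + r) \<or> (z = x + r \<and> y = z + r)"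
    using assms(2-4) by auto
  moreover have "(x + r) + (x + r) = x + (x + r + r)" by (simp add: ac_simps)
  ultimately show ?thesis unfolding ap3_def by metis
next
  case (refl a)
  have "a - x \<in> {x,y,z}" "a - y \<in> {x,y,z}" "a - z \<in> {x,y,z}"
    using refl unfolding refl_inv_def by blast+
  then have "a = x + x \<or> a = x + y \<or> a = x + z" "a = x + y \<or> a = y + y \<or> a = y + z"
     "a = x + z \<or> a = y + z \<or> a = z + z"
    unfolding insert_iff empty_iff diff_eq_eq by (metis add.commute)+
  moreover have "\<not> (a = x + x \<and> a = y + y \<and> a = z + z)"
    using double_eq_triple[of x y z] assms(2-4) by auto
  moreover have "\<not> (a = x + y \<and> a = x + z)" "\<not> (a = x + y \<and> a = y + z)" "\<not> (a = x + z \<and> a = y + z)"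
    using assms(2-4) by (metis add.commute add_left_cancel)+
  ultimately show ?thesis unfolding ap3_def by argo
qed

text \<open>\<open>K\<close> is the coset of the stabilizer of \<open>P\<close> that contains
  \<open>D\<close>; it misses \<open>P\<close>, and \<open>P\<close> is a union of such cosets. A
  symmetry of \<open>P \<union> D\<close> that preserves \<open>K\<close> restricts to
  \<open>D\<close>. One that moves \<open>K\<close> to another coset makes membership in
  \<open>D\<close> constant on \<open>K\<close>, so \<open>D = K\<close>, which has the period
  \<open>h\<close>.\<close>

lemma sym_set_coset_part:
  assumes D: "d \<in> D" "\<And>u. u \<in> D \<Longrightarrow> rot_inv (u - d) P" and d: "d \<notin> P"
    and h: "h \<noteq> 0" "rot_inv h P" and sym: "sym_set (P \<union> D)"
  shows "sym_set D"
proof -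
  define K where "K = {u. rot_inv (u - d) P}"
  have dK: "d \<in> K" by (simp add: K_def)
  have DK: "D \<subseteq> K" using D(2) by (auto simp: K_def)
  have KP: "u \<notin> P" if "u \<in> K" for u using that rot_invD[of u d P] d by (auto simp: K_def)
  have diffK: "rot_inv (u - v) P" if "u \<in> K" "v \<in> K" for u v
    using rot_inv_diff[of "u - d" P "v - d"] that by (simp add: K_def)
  have addK: "u + r \<in> K \<longleftrightarrow> u \<in> K" if "rot_inv r P" for u r
    using rot_inv_add[of "u - d" P r] rot_inv_diff[of "u + r - d" P r] that
    by (auto simp: K_def algebra_simps)
  have symK: "sym_set K"
    using addK[OF h(2)] h(1) by (auto simp: sym_set_def rot_inv_def)
  from sym show ?thesis
  proof (cases rule: sym_set_cases)
    case (rot r)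
    have inv: "t + r \<in> P \<union> D \<longleftrightarrow> t \<in> P \<union> D" for t using rot(2) by (auto simp: rot_inv_def)
    show ?thesis
    proof (cases "rot_inv r P")
      case True
      then have "t + r \<in> D \<longleftrightarrow> t \<in> D" for t
        using inv[of t] addK[of r t] KP DK by blast
      then show ?thesis using rot(1) by (auto simp: sym_set_def rot_inv_def)
    next
      case False
      have "t - r \<in> P \<longleftrightarrow> t \<in> D" if "t \<in> K" for t
      proof -
        have "t - r \<notin> D" using diffK[of t "t - r"] that False DK by auto
        then show ?thesis using inv[of "t - r"] KP[OF that] by auto
      qed
      then have "t \<in> D" if "t \<in> K" for t
        using dK D(1) that diffK[OF that dK] rot_invD[of "t - r" "d - r" P] by simp
      with DK have "D = K" by blast
      with symK show ?thesis by simp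
    qed
  next
    case (refl a)
    have inv: "a - t \<in> P \<union> D \<longleftrightarrow> t \<in> P \<union> D" for t using refl by (auto simp: refl_inv_def)
    have eq: "(a - t) - d = (a - d - d) - (t - d)" for t by (simp add: algebra_simps)
    have eq': "a - d - d = ((a - t) - d) + (t - d)" for t by (simp add: algebra_simps)
    show ?thesis
    \<comment> \<open>For \<open>t\<close> in \<open>K\<close>, the point \<open>a - t\<close> lies
      in \<open>K\<close> exactly when \<open>a - d - d\<close> is a period of \<open>P\<close>, so
      this decides whether the reflection preserves \<open>K\<close>.\<close>
    proof (cases "rot_inv (a - d - d) P")
      case True
      have "a - t \<in> K \<longleftrightarrow> t \<in> K" for t
      proof
        show "t \<in> K \<Longrightarrow> a - t \<in> K"
          using rot_inv_diff[OF True, of "t - d"] unfolding K_def mem_Collect_eq eq[of t] .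
        have "t - d = (a - d - d) - ((a - t) - d)" by (simp add: algebra_simps)
        then show "a - t \<in> K \<Longrightarrow> t \<in> K"
          using rot_inv_diff[OF True, of "(a - t) - d"] unfolding K_def mem_Collect_eq by metis
      qed
      then have "a - t \<in> D \<longleftrightarrow> t \<in> D" for t
        using inv[of t] KP DK by blast
      then show ?thesis by (auto simp: sym_set_def refl_inv_def)
    next
      case False
      have "a - t \<in> P \<longleftrightarrow> t \<in> D" if "t \<in> K" for t
      proof -
        have "a - t \<notin> K"
        proof
          assume "a - t \<in> K"
          then have "rot_inv (((a - t) - d) + (t - d)) P"
            using that unfolding K_def by (intro rot_inv_add) simp_all
          then show False using False unfolding eq'[of t, symmetric] by blast
        qed
        then have "a - t \<notin> D" using DK by auto
        then show ?thesis using inv[of t] KP[OF that] by auto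
      qed
      moreover have "a - t \<in> P \<longleftrightarrow> a - d \<in> P" if "t \<in> K" for t
        using diffK[OF dK that] by (intro rot_invD) (simp add: algebra_simps)
      ultimately have "t \<in> D" if "t \<in> K" for t
        using dK D(1) that by blast
      with DK have "D = K" by blast
      with symK show ?thesis by simp
    qed
  qed
qed

text \<open>Adding \<open>h\<close> leads from \<open>x\<close> out of the set, whereas a
  translation by \<open>h\<close> or \<open>- h\<close> never leads out of \<open>P\<close>. So no
  symmetry can send \<open>x\<close> into \<open>P\<close>, and it must fix \<open>x\<close>. This
  excludes rotations and gives \<open>a = x + x\<close>.\<close>

lemma refl_inv_if_sym_insert:
  assumes P: "h \<noteq> 0" "rot_inv h P" and x: "x \<notin> P" and sym: "sym_set (P \<union> {x})"
  shows "refl_inv (x + x) P"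
  using sym
proof (cases rule: sym_set_cases)
  case (rot r)
  have "x + h \<notin> P" using P(2) x by (simp add: rot_inv_def)
  then have "x + h \<notin> P \<union> {x}" using P(1) by simp
  then have "x + h + r \<notin> P \<union> {x}" using rot(2) unfolding rot_inv_def by blast
  then have "x + r + h \<notin> P" by (simp add: ac_simps)
  then have "x + r \<notin> P" using P(2) by (simp add: rot_inv_def)
  moreover have "x + r \<in> P \<union> {x}" using rot(2) unfolding rot_inv_def by blast
  ultimately show ?thesis using rot(1) by simp
next
  case (refl a)
  have "x + h \<notin> P" using P(2) x by (simp add: rot_inv_def)
  then have "x + h \<notin> P \<union> {x}" using P(1) by simp
  then have "a - (x + h) \<notin> P \<union> {x}" using refl unfolding refl_inv_def by blast
  then have "a - x \<notin> P" using rot_invD[of "a - x" "a - (x + h)" P] P(2) by simp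
  moreover have "a - x \<in> P \<union> {x}" using refl unfolding refl_inv_def by blast
  ultimately have "a - x = x" by simp
  then have a: "a = x + x" by (simp add: algebra_simps)
  have "a - t = x \<longleftrightarrow> t = x" for t using a by (auto simp: algebra_simps)
  then have "a - t \<in> P \<longleftrightarrow> t \<in> P" for t
    using refl x unfolding refl_inv_def by (cases "t = x") (auto simp: a)
  then show ?thesis using a by (simp add: refl_inv_def)
qed

text \<open>As each of \<open>x\<close> and \<open>y\<close> is alone in its coset, a symmetry
  permutes \<open>{x, y}\<close>. A rotation swaps them, so twice its angle is 0. A reflection that
  swaps them also preserves \<open>P\<close>; composed with the reflection at \<open>x\<close> it
  would give \<open>P\<close> the period \<open>y - x\<close>. So a reflection fixes both.\<close>

lemma double_eq_if_sym_insert2: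
  assumes P: "h \<noteq> 0" "rot_inv h P" and x: "x \<notin> P" "y \<notin> P" "\<not> rot_inv (y - x) P"
    and Rx: "refl_inv (x + x) P" and sym: "sym_set (P \<union> {x, y})"
  shows "x + x = y + y"
proof -
  have "\<not> rot_inv (x - y) P" using x(3) rot_inv_minus[of "x - y" P] by auto
  have xh: "x + h \<notin> P \<union> {x, y}"
  proof -
    have "x + h \<noteq> y" using x(3) P(2) by auto
    moreover have "x + h \<notin> P" using P(2) x by (simp add: rot_inv_def)
    ultimately show ?thesis using P(1) by simp
  qed
  have yh: "y + h \<notin> P \<union> {x, y}"
  proof -
    have "y + h \<noteq> x" using \<open>\<not> rot_inv (x - y) P\<close> P(2) by auto
    moreover have "y + h \<notin> P" using P(2) x by (simp add: rot_inv_def)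
    ultimately show ?thesis using P(1) by simp
  qed
  have neq: "x \<noteq> y" using x(3) by auto
  from sym show ?thesis
  proof (cases rule: sym_set_cases)
    case (rot r)
    have *: "u + r \<in> {x, y}" if "u \<in> {x, y}" "u + h \<notin> P \<union> {x, y}" for u
    proof -
      have "u + h + r \<notin> P \<union> {x, y}" using rot(2) that(2) unfolding rot_inv_def by blast
      then have "u + r + h \<notin> P" by (simp add: ac_simps)
      then have "u + r \<notin> P" using P(2) by (simp add: rot_inv_def)
      moreover have "u + r \<in> P \<union> {x, y}" using rot(2) that unfolding rot_inv_def by blast
      ultimately show ?thesis by blast
    qed
    have "x + r = y" "y + r = x" using *[of x] *[of y] xh yh rot(1) by auto
    moreover have "x + (y + r) = (x + r) + y" by (simp add: ac_simps)
    ultimately show ?thesis by metis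
  next
    case (refl a)
    have *: "a - u \<in> {x, y}" if "u \<in> {x, y}" "u + h \<notin> P \<union> {x, y}" for u
    proof -
      have "a - (u + h) \<notin> P \<union> {x, y}" using refl that(2) unfolding refl_inv_def by blast
      then have "a - u \<notin> P" using P(2) rot_invD[of "a - u" "a - (u + h)" P] by simp
      moreover have "a - u \<in> P \<union> {x, y}" using refl that unfolding refl_inv_def by blast
      ultimately show ?thesis by blast
    qed
    have ax: "a - x = x \<or> a - x = y" "a - y = x \<or> a - y = y" using *[of x] *[of y] xh yh by auto
    show ?thesis
    proof (cases "a - x = y")
      case True
      then have a: "a = x + y" by (simp add: algebra_simps)
      have xy: "a - t \<in> {x, y} \<longleftrightarrow> t \<in> {x, y}" for t
        unfolding a by (auto simp: diff_eq_eq add.commute)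
      have inv: "a - t \<in> P \<union> {x, y} \<longleftrightarrow> t \<in> P \<union> {x, y}" for t
        using refl unfolding refl_inv_def by blast
      have "a - t \<in> P \<longleftrightarrow> t \<in> P" for t
        using xy[of t] inv[of t] x by auto
      then have "refl_inv a P" by (simp add: refl_inv_def)
      from refl_inv_diff[OF this Rx] have "rot_inv (y - x) P" by (simp add: a)
      with x(3) show ?thesis by blast
    next
      case False
      then have "a - x = x" using ax by simp
      moreover from this have "a - y \<noteq> x" using neq by (metis diff_eq_eq add.commute add_left_cancel)
      ultimately have "a - y = y" "a - x = x" using ax by auto
      then show ?thesis by (metis diff_eq_eq)
    qed
  qed
qed

text \<open>If the three points did not share a coset of the stabilizer of \<open>P\<close>, one of
  them would lie apart from both others, and all three doubles would agree, which
  \<open>double_eq_triple\<close> forbids. So they share a coset, and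
  \<open>sym_set_coset_part\<close> reduces the claim to the symmetry of \<open>{x, y, z}\<close>
  itself.\<close>

lemma ap3_if_rot:
  fixes x y z :: "'a::unique_involution"
  assumes P: "h \<noteq> 0" "rot_inv h P" and dist: "x \<noteq> y" "x \<noteq> z" "y \<noteq> z"
    and out: "x \<notin> P" "y \<notin> P" "z \<notin> P"
    and sym: "\<And>D. D \<subseteq> {x, y, z} \<Longrightarrow> sym_set (P \<union> D)"
  shows "ap3 x y z"
proof -
  have R: "refl_inv (u + u) P" if "u \<in> {x,y,z}" for u
    using refl_inv_if_sym_insert[OF P, of u] sym[of "{u}"] that out by auto
  have E: "u + u = v + v" if "u \<in> {x,y,z}" "v \<in> {x,y,z}" "\<not> rot_inv (v - u) P" for u v
    using double_eq_if_sym_insert2[OF P _ _ that(3) R[OF that(1)]] sym[of "{u, v}"] that out by auto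
  have coset: "\<exists>d\<in>{x,y,z}. \<forall>u\<in>{x,y,z}. rot_inv (u - d) P"
  proof (rule ccontr)
    assume no: "\<not> ?thesis"
    have **: "rot_inv (u - v) P \<Longrightarrow> rot_inv (v - u) P" for u v
      using rot_inv_minus[of "u - v" P] by simp
    from no obtain u v w where "{u, v, w} = {x, y, z}" "\<not> rot_inv (v - u) P" "\<not> rot_inv (w - u) P" "v \<noteq> w" "u \<noteq> v" "u \<noteq> w"
    proof -
      have "\<not> (rot_inv (y - x) P \<and> rot_inv (z - x) P)" "\<not> (rot_inv (x - y) P \<and> rot_inv (z - y) P)"
        "\<not> (rot_inv (x - z) P \<and> rot_inv (y - z) P)"
        using no by auto
      with **[of x y] **[of y x] **[of x z] **[of z x] **[of y z] **[of z y]
      have "(\<not> rot_inv (y - x) P \<and> \<not> rot_inv (z - x) P) \<or> (\<not> rot_inv (x - y) P \<and> \<not> rot_inv (z - y) P)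
        \<or> (\<not> rot_inv (x - z) P \<and> \<not> rot_inv (y - z) P)"
        by argo
      then show ?thesis using that[of x y z] that[of y x z] that[of z x y] dist by fast
    qed
    then have "u + u = v + v" "u + u = w + w" using E[of u v] E[of u w] by blast+
    then show False using double_eq_triple \<open>v \<noteq> w\<close> \<open>u \<noteq> v\<close> \<open>u \<noteq> w\<close> by blast
  qed
  then obtain d where "d \<in> {x,y,z}" "\<forall>u\<in>{x,y,z}. rot_inv (u - d) P" by blast
  then have "sym_set {x,y,z}"
    using sym_set_coset_part[OF _ _ _ P, of d "{x,y,z}"] sym[of "{x,y,z}"] out by blast
  then show ?thesis using sym3_imp_ap3 dist by blast
qed

subsection \<open>Quadruples of points in progression\<close>

lemma zero_if_seven_torsion:
  fixes t :: "'a::ab_group_add"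
  assumes "t + t + t + t + t + t + t = 0"
  shows "t + t + t = 0 \<Longrightarrow> t = 0" "t + t = 0 \<Longrightarrow> t = 0" "t + t + t + t + t = 0 \<Longrightarrow> t = 0"
proof -
  show "t = 0" if "t + t + t = 0"
  proof -
    have "(t + t + t) + (t + t + t) + t = 0" using assms by (simp add: ac_simps)
    then show ?thesis unfolding that by simp
  qed
  show 2: "t = 0" if "t + t = 0"
  proof -
    have "(t + t) + (t + t) + (t + t) + t = 0" using assms by (simp add: ac_simps)
    then show ?thesis unfolding that by simp
  qed
  show "t = 0" if "t + t + t + t + t = 0"
  proof -
    have "(t + t + t + t + t) + (t + t) = 0" using assms by (simp add: ac_simps)
    then show ?thesis unfolding that using 2 by simp
  qed
qed

text \<open>The iterate is the \<open>k\<close>-fold sum of \<open>x\<close>; on the circle this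
  says that \<open>x\<close> is a \<open>k\<close>-th root of unity.\<close>

definition torsion :: "nat \<Rightarrow> 'a::ab_group_add \<Rightarrow> bool" where
  "torsion k x \<longleftrightarrow> ((+) x ^^ k) 0 = 0"

lemma torsion_4: "torsion 4 x \<longleftrightarrow> x + x + (x + x) = 0"
  and torsion_5: "torsion 5 x \<longleftrightarrow> x + x + (x + x) + x = 0"
  by (simp_all add: torsion_def numeral_eq_Suc ac_simps)

lemma torsion_minus: "torsion 4 (- x) \<longleftrightarrow> torsion 4 x" "torsion 5 (- x) \<longleftrightarrow> torsion 5 x"
proof -
  have "- x + - x + (- x + - x) = - (x + x + (x + x))" "- x + - x + (- x + - x) + - x = - (x + x + (x + x) + x)"
    by simp_all
  then show "torsion 4 (- x) \<longleftrightarrow> torsion 4 x" "torsion 5 (- x) \<longleftrightarrow> torsion 5 x"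
    unfolding torsion_4 torsion_5 by (metis neg_equal_0_iff_equal)+
qed

lemma ap3_0: "ap3 0 x y \<longleftrightarrow> y = - x \<or> y = x + x \<or> x = y + y"
  unfolding ap3_def add_0_left add_0_right by (metis minus_unique right_minus)

text \<open>Since \<open>z\<close> differs from both \<open>x\<close> and \<open>- x\<close>, it is
  the double or the half of each. The four combinations give 4x = 0, 5x = 0, 5z = 0 or the excluded
  \<open>x = - x\<close>.\<close>

lemma ap3_opposite:
  fixes x z :: "'a::ab_group_add"
  assumes "x \<noteq> - x" "z \<noteq> x" "z \<noteq> - x" "ap3 0 x z" "ap3 0 (- x) z"
  shows "ap3 x (- x) z" "(torsion 4 x \<and> torsion 4 z) \<or> (torsion 5 x \<and> torsion 5 z)"
proof -
  have 1: "z = x + x \<or> x = z + z"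
    using assms(3,4) unfolding ap3_0 by blast
  have 2: "z = - x + - x \<or> - x = z + z"
    using assms(2,5) unfolding ap3_0 minus_minus by blast
  consider (a) "z = x + x" "z = - x + - x" | (b) "z = x + x" "- x = z + z"
    | (c) "x = z + z" "z = - x + - x" | (d) "x = z + z" "- x = z + z"
    using 1 2 by blast
  then have "ap3 x (- x) z \<and> ((torsion 4 x \<and> torsion 4 z) \<or> (torsion 5 x \<and> torsion 5 z))"
  proof cases
    case a
    have "z + z = (x + x) + (- x + - x)" using a by metis
    then have z: "z + z = 0" by simp
    then have "torsion 4 x" using a(1) by (simp add: torsion_4)
    moreover have "torsion 4 z" unfolding torsion_4 z by simp
    ultimately show ?thesis using z by (simp add: ap3_def)
  next
    case b
    have "z + z + x = 0" unfolding b(2)[symmetric] by simp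
    then have e: "x + x + (x + x) + x = 0" unfolding b(1) .
    have "z + z + (z + z) + z = (x + x + (x + x) + x) + (x + x + (x + x) + x)"
      unfolding b(1) by (simp add: ac_simps)
    then have "torsion 5 z" unfolding e torsion_5 by simp
    moreover have "- x + - x = x + z"
    proof -
      have "- x + - x = z + z + - x" unfolding b(2) ..
      also have "\<dots> = x + z" unfolding b(1) by simp
      finally show ?thesis .
    qed
    ultimately show ?thesis using e by (simp only: ap3_def torsion_5 simp_thms)
  next
    case c
    have "z + (x + x) = 0" by (subst c(2)) simp
    then have e: "z + z + (z + z) + z = 0" unfolding c(1) by (simp add: ac_simps)
    have "x + x + (x + x) + x = (z + z + (z + z) + z) + (z + z + (z + z) + z)"
      unfolding c(1) by (simp add: ac_simps)
    then have "torsion 5 x" unfolding e torsion_5 by simp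
    moreover have "x + x = - x + z"
    proof -
      have "x + (x + x) = (z + z) + (x + x)" unfolding c(1)[symmetric] ..
      also have "\<dots> = z + (z + (x + x))" by (simp only: add.assoc)
      finally have "x + (x + x) = z" unfolding \<open>z + (x + x) = 0\<close> by simp
      then have "- x + z = - x + (x + (x + x))" by metis
      then show ?thesis by simp
    qed
    ultimately show ?thesis using e by (simp only: ap3_def torsion_5 simp_thms)
  next
    case d
    then show ?thesis using assms(1) by metis
  qed
  then show "ap3 x (- x) z" "(torsion 4 x \<and> torsion 4 z) \<or> (torsion 5 x \<and> torsion 5 z)"
    by blast+
qed

text \<open>
  These triples are \<open>t\<close>, \<open>2t\<close>, \<open>4t\<close> with \<open>7t = 0\<close>: the only triples that form progressions
  pairwise with \<open>0\<close> without being a progression themselves.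
\<close>

definition doubling_cycle :: "'a::ab_group_add \<Rightarrow> 'a \<Rightarrow> 'a \<Rightarrow> bool" where
  "doubling_cycle x y z \<longleftrightarrow> x = z + z \<and> y = x + x \<and> z = y + y"

text \<open>Each pair is opposite or consists of an element and its double. Without an opposite
  pair, orient every pair from the element to its double: each point has only one double, so the
  three arrows form a cycle, in one of two directions.\<close>

lemma ap3_0_cases:
  fixes x y z :: "'a::ab_group_add"
  assumes dist: "x \<noteq> y" "x \<noteq> z" "y \<noteq> z"
    and ap: "ap3 0 x y" "ap3 0 x z" "ap3 0 y z"
  shows "(ap3 x y z \<and> ((torsion 4 x \<and> torsion 4 y \<and> torsion 4 z) \<or> (torsion 5 x \<and> torsion 5 y \<and> torsion 5 z)))
    \<or> doubling_cycle x y z \<or> doubling_cycle x z y"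
proof -
  consider (xy) "y = - x" | (xz) "z = - x" | (yz) "z = - y"
    | (d) "y = x + x \<or> x = y + y" "z = x + x \<or> x = z + z" "z = y + y \<or> y = z + z"
    using ap unfolding ap3_0 by blast
  then show ?thesis
  proof cases
    case xy
    with ap3_opposite[of x z] assms torsion_minus[of x] show ?thesis by simp
  next
    case xz
    have "ap3 0 (- x) y" using ap(3) ap3_commute(2) unfolding xz by blast
    with xz ap3_opposite[of x y] assms torsion_minus[of x] ap3_commute(2)[of x y z] show ?thesis by auto
  next
    case yz
    have "ap3 0 (- y) x" "ap3 0 y x" using ap(1,2) ap3_commute(2) unfolding yz by blast+
    with yz ap3_opposite[of y x] assms torsion_minus[of y] ap3_commute(2)[of y z x] ap3_commute(1)[of y x z]
    show ?thesis by auto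
  next
    case d
    then show ?thesis using dist unfolding doubling_cycle_def by metis
  qed
qed


lemma doubling_cycleD:
  assumes "doubling_cycle x y z"
  shows "x = z + z" "y = z + z + (z + z)" "z + z + z + z + z + z + z = 0"
proof -
  show x: "x = z + z" using assms unfolding doubling_cycle_def by blast
  have "y = x + x" using assms unfolding doubling_cycle_def by blast
  then show y: "y = z + z + (z + z)" unfolding x .
  have "z = y + y" using assms unfolding doubling_cycle_def by blast
  also have "\<dots> = z + (z + z + z + z + z + z + z)" unfolding y by (simp add: ac_simps)
  finally show "z + z + z + z + z + z + z = 0" by (metis add.right_neutral add_left_cancel)
qed

text \<open>In multiples of \<open>z\<close> the set is {0, 1, 2, 4} modulo 7. The image of 0 shows
  that \<open>r\<close> or \<open>a\<close> belongs to the set, and for each candidate some point is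
  sent to 3, 5 or 6.\<close>

lemma doubling_cycle_not_sym:
  fixes x y z :: "'a::ab_group_add"
  assumes t: "doubling_cycle x y z" and z: "z \<noteq> 0" and sym: "sym_set {0, x, y, z}"
  shows False
proof -
  note x = doubling_cycleD(1)[OF t] and y = doubling_cycleD(2)[OF t] and 7 = doubling_cycleD(3)[OF t]
  have z2: "z + z \<noteq> 0" and z3: "z + z + z \<noteq> 0" and z5: "z + z + z + z + z \<noteq> 0"
    using z zero_if_seven_torsion[OF 7] by blast+
  have z4: "z + z + (z + z) \<noteq> 0"
  proof
    assume *: "z + z + (z + z) = 0"
    have "z + z + (z + z) + (z + z + z) = 0" using 7 by (simp add: ac_simps)
    then show False unfolding * using z3 by simp
  qed
  have out: "z + z + z \<notin> {0, x, y, z}"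
    using z z2 z3 unfolding x y by simp
  have "z + z + z + z + z = (z + z) + (z + z + z)" "z + z + z + z + z = (z + z + (z + z)) + z"
    "z + z + z + z + z = z + (z + z + (z + z))" by (simp_all only: add.assoc)
  then have "z + z + z + z + z \<noteq> z + z" "z + z + z + z + z \<noteq> z + z + (z + z)" "z + z + z + z + z \<noteq> z"
    using z z3 z4 by (metis add.right_neutral add_left_cancel)+
  with z5 have out2: "z + z + z + z + z \<notin> {0, x, y, z}"
    unfolding x y by blast
  have out3: "- z \<notin> {0, x, y, z}"
  proof -
    have "- z + z = 0" by simp
    moreover have "z + z + (z + z) + z = z + z + z + z + z" by (simp only: add.assoc)
    ultimately have "- z \<noteq> z + z + (z + z)" "- z \<noteq> z + z" "- z \<noteq> z"
      using z2 z3 z5 by metis+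
    then show ?thesis using z unfolding x y by simp
  qed
  from sym show False
  proof (cases rule: sym_set_cases)
    case (rot r)
    have *: "t + r \<in> {0, x, y, z}" if "t \<in> {0, x, y, z}" for t
      using rot(2) that unfolding rot_inv_def by blast
    have "r \<in> {0, x, y, z}" using *[of 0] by simp
    then consider "r = x" | "r = y" | "r = z" using rot(1) by blast
    then show False
    proof cases
      case 1
      then show False using *[of z] out x by (simp add: ac_simps)
    next
      case 2
      then show False using *[of z] out2 y by (simp add: ac_simps)
    next
      case 3
      then show False using *[of x] out x by (simp add: ac_simps)
    qed
  next
    case (refl a)
    have *: "a - t \<in> {0, x, y, z}" if "t \<in> {0, x, y, z}" for t
      using refl that unfolding refl_inv_def by blast
    have "a \<in> {0, x, y, z}" using *[of 0] by simp
    then consider "a = 0" | "a = x" | "a = y" | "a = z" by blast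
    then show False
    proof cases
      case 1
      then show False using *[of z] out3 by simp
    next
      case 2
      \<comment> \<open>The coefficient 2 - 4 is written as 5 - 7, so that 7z = 0 applies.\<close>
      have "x - y = z + z + z + z + z - (z + z + z + z + z + z + z)" unfolding x y by (simp add: algebra_simps)
      then show False using *[of y] out2 7 2 by simp
    next
      case 3
      have "y - z = z + z + z" unfolding y by (simp add: algebra_simps)
      then show False using *[of z] out 3 by simp
    next
      case 4
      have "z - x = - z" unfolding x by (simp add: algebra_simps)
      then show False using *[of x] out3 4 by simp
    qed
  qed
qed

text \<open>In multiples of \<open>z\<close> the three possible progression equations become z = 0,
  5z = 0 and 4z = 0, each incompatible with 7z = 0.\<close>

lemma doubling_cycle_not_ap3:
  fixes x y z :: "'a::ab_group_add"
  assumes t: "doubling_cycle x y z" and z: "z \<noteq> 0"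
  shows "\<not> ap3 x y z"
proof -
  note x = doubling_cycleD(1)[OF t] and y = doubling_cycleD(2)[OF t] and 7 = doubling_cycleD(3)[OF t]
  note nz = zero_if_seven_torsion[OF 7]
  show ?thesis
  proof
    assume "ap3 x y z"
    then consider "z + z + (z + z) = z + z + (z + z) + z" | "z + z + (z + z) + (z + z + (z + z)) = z + z + z"
      | "z + z = z + z + (z + z + (z + z))"
      unfolding ap3_def x y by blast
    then show False
    proof cases
      case 1
      then have "z = 0" by (metis add.right_neutral add_left_cancel)
      then show False using z by simp
    next
      case 2
      then have "(z + z + z) + (z + z + z + z + z) = z + z + z + 0" by (simp add: ac_simps)
      then have "z + z + z + z + z = 0" by (metis add_left_cancel)
      then show False using nz z by blast
    next
      case 3
      then have "(z + z) + (z + z + z + z) = z + z + 0" by (simp add: ac_simps)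
      then have "z + z + z + z = 0" by (metis add_left_cancel)
      moreover have "(z + z + z + z) + (z + z + z) = 0" using 7 by (simp add: ac_simps)
      ultimately have "z + z + z = 0" by simp
      then show False using nz z by blast
    qed
  qed
qed

lemma ap3_translate: "ap3 (x - q) (y - q) (z - q) \<longleftrightarrow> ap3 x y z"
proof -
  have "(a - q) + (a - q) = (b - q) + (c - q) \<longleftrightarrow> a + a = b + c" for a b c
    unfolding add_diff_add[symmetric] by simp
  then show ?thesis unfolding ap3_def by simp
qed

lemma sym_set_translate: "sym_set S \<Longrightarrow> sym_set ((\<lambda>t. t - q) ` S)"
proof (erule sym_set_cases)
  have im: "u \<in> (\<lambda>t. t - q) ` S \<longleftrightarrow> u + q \<in> S" for u
    by (auto intro!: image_eqI[where x = "u + q"])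
  {
    fix r assume "r \<noteq> 0" "rot_inv r S"
    then have "(u + r) + q \<in> S \<longleftrightarrow> u + q \<in> S" for u
      unfolding rot_inv_def by (metis add.assoc add.commute)
    then show "sym_set ((\<lambda>t. t - q) ` S)"
      using \<open>r \<noteq> 0\<close> unfolding sym_set_def rot_inv_def im by blast
  next
    fix a assume "refl_inv a S"
    then have "a - (u + q) \<in> S \<longleftrightarrow> u + q \<in> S" for u
      unfolding refl_inv_def by blast
    moreover have "(a - q - q) - u + q = a - (u + q)" for u by (simp add: algebra_simps)
    ultimately have "refl_inv (a - q - q) ((\<lambda>t. t - q) ` S)" unfolding refl_inv_def im by metis
    then show "sym_set ((\<lambda>t. t - q) ` S)" unfolding sym_set_def by blast
  }
qed

text \<open>After translating \<open>q\<close> to 0, only the doubling cycles have to be excluded.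
  Either alternative of the last assumption does so: symmetry of the quadruple when
  \<open>ap3 x y z\<close> is still to be shown, \<open>ap3 x y z\<close> when only the torsion is
  wanted.\<close>

lemma ap3_quadruple:
  fixes q x y z :: "'a::ab_group_add"
  assumes dist: "x \<noteq> y" "x \<noteq> z" "y \<noteq> z" "x \<noteq> q" "y \<noteq> q" "z \<noteq> q"
    and ap: "ap3 q x y" "ap3 q x z" "ap3 q y z"
    and "ap3 x y z \<or> sym_set {q, x, y, z}"
  shows "ap3 x y z"
    "(torsion 4 (x - q) \<and> torsion 4 (y - q) \<and> torsion 4 (z - q))
      \<or> (torsion 5 (x - q) \<and> torsion 5 (y - q) \<and> torsion 5 (z - q))"
proof -
  have "ap3 0 (x - q) (y - q)" "ap3 0 (x - q) (z - q)" "ap3 0 (y - q) (z - q)"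
    using ap[THEN iffD2[OF ap3_translate[where q = q]]] unfolding diff_self by blast+
  moreover have "x - q \<noteq> y - q" "x - q \<noteq> z - q" "y - q \<noteq> z - q" using dist by simp_all
  ultimately  consider "ap3 x y z" "(torsion 4 (x - q) \<and> torsion 4 (y - q) \<and> torsion 4 (z - q))
      \<or> (torsion 5 (x - q) \<and> torsion 5 (y - q) \<and> torsion 5 (z - q))"
    | "doubling_cycle (x - q) (y - q) (z - q)" | "doubling_cycle (x - q) (z - q) (y - q)"
    using ap3_0_cases[of "x - q" "y - q" "z - q"] unfolding ap3_translate by blast
  then have "ap3 x y z \<and> ((torsion 4 (x - q) \<and> torsion 4 (y - q) \<and> torsion 4 (z - q))
      \<or> (torsion 5 (x - q) \<and> torsion 5 (y - q) \<and> torsion 5 (z - q)))"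
  proof cases
    case 1
    then show ?thesis by blast
  next
    case 2
    have "\<not> ap3 x y z" using doubling_cycle_not_ap3[OF 2] dist(6) unfolding ap3_translate by simp
    moreover have "\<not> sym_set {q, x, y, z}"
      using doubling_cycle_not_sym[OF 2] dist(6) sym_set_translate[of "{q, x, y, z}" q] by fastforce
    ultimately show ?thesis using assms(10) by blast
  next
    case 3
    have "\<not> ap3 x z y" using doubling_cycle_not_ap3[OF 3] dist(5) unfolding ap3_translate by simp
    moreover have "\<not> sym_set {q, x, z, y}"
      using doubling_cycle_not_sym[OF 3] dist(5) sym_set_translate[of "{q, x, z, y}" q] by fastforce
    ultimately show ?thesis using assms(10) unfolding ap3_commute(2)[of x y z] insert_commute[of y z] by blast
  qed
  then show "ap3 x y z"
    "(torsion 4 (x - q) \<and> torsion 4 (y - q) \<and> torsion 4 (z - q))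
      \<or> (torsion 5 (x - q) \<and> torsion 5 (y - q) \<and> torsion 5 (z - q))"
    by blast+
qed

subsection \<open>Triples all of whose extensions are symmetric\<close>

text \<open>Suppose \<open>z\<close> lies in another coset. In \<open>Q\<close>, the coset of
  \<open>q\<close> misses \<open>y\<close> and the coset of \<open>z\<close> misses
  \<open>z + h\<close>, so no symmetry sends \<open>q\<close>, \<open>x\<close> or \<open>z\<close>
  into \<open>P\<close>, which consists of full cosets. The symmetry thus permutes the three points
  and, respecting cosets, preserves \<open>{q, x}\<close> and fixes \<open>z\<close>. No rotation
  does this; a reflection swapping \<open>q\<close> and \<open>x\<close> has
  \<open>q + x = z + z = q + q\<close>, and one fixing both would fix three points.\<close>

lemma sym_insert3_same_coset:
  fixes q x y z :: "'a::unique_involution"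
  assumes coset: "rot_inv (x - q) P" "rot_inv (y - q) P" and dist: "x \<noteq> q" "y \<noteq> q" "x \<noteq> y"
    and out: "q \<notin> P" "x \<notin> P" "y \<notin> P" "z \<notin> P" and zq: "z + z = q + q"
    and sym: "sym_set (P \<union> {q, x, z})"
  shows "rot_inv (z - q) P"
proof (rule ccontr)
  assume N: "\<not> rot_inv (z - q) P"
  define Q where "Q = P \<union> {q, x, z}"
  define h where "h = x - q"
  have h: "h \<noteq> 0" "rot_inv h P" using dist coset by (simp_all add: h_def)
  have trans: "rot_inv (u - v) P" if "rot_inv (u - w) P" "rot_inv (v - w) P" for u v w
    using rot_inv_diff[OF that] by simp
  have flip: "rot_inv (u - v) P" if "rot_inv (v - u) P" for u v
    using rot_inv_minus[OF that] by simp
  have Nz: "\<not> rot_inv (z - x) P" "\<not> rot_inv (q - z) P" "\<not> rot_inv (x - z) P" "\<not> rot_inv (z - q) P"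
    using N trans[OF _ flip[OF coset(1)], of z] flip by blast+
  have zne: "z \<noteq> q" "z \<noteq> x" "z \<noteq> y" using N coset by auto
  have yQ: "y \<notin> Q" using out dist zne by (auto simp: Q_def)
  have yx: "rot_inv (y - u) P" if "u \<in> {q, x}" for u
    using that coset trans[OF coset(2,1)] by auto
  have zh: "z + h \<notin> Q"
  proof -
    have "z + h \<notin> P" using h(2) out(4) by (simp add: rot_inv_def)
    moreover have "z + h \<noteq> q" using Nz(2) h(2) by auto
    moreover have "z + h \<noteq> x" using zne by (auto simp: h_def add_diff_eq diff_eq_eq)
    ultimately show ?thesis using h(1) by (simp add: Q_def)
  qed
  from sym have "sym_set Q" by (simp add: Q_def)
  then show False
  proof (cases rule: sym_set_cases)
    case (rot r)
    have inv: "t + r \<in> Q \<longleftrightarrow> t \<in> Q" for t using rot(2) by (simp add: rot_inv_def)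
    have *: "u + r \<in> {q, x, z}" if "u \<in> {q, x}" for u
    proof -
      have "rot_inv ((y + r) - (u + r)) P" using yx[OF that] by simp
      moreover have "y + r \<notin> P" using inv[of y] yQ by (auto simp: Q_def)
      ultimately have "u + r \<notin> P" using rot_invD by blast
      moreover have "u + r \<in> Q" using inv[of u] that by (auto simp: Q_def)
      ultimately show ?thesis by (simp add: Q_def)
    qed
    have "z + r \<notin> P"
    proof -
      have "rot_inv ((z + h + r) - (z + r)) P" using h(2) by (simp add: algebra_simps)
      moreover have "z + h + r \<notin> P" using inv[of "z + h"] zh by (auto simp: Q_def)
      ultimately show ?thesis using rot_invD by blast
    qed
    moreover have "z + r \<in> Q" using inv[of z] by (simp add: Q_def)
    ultimately have zr: "z + r \<in> {q, x, z}" by (simp add: Q_def)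
    have d: "rot_inv ((x + r) - (q + r)) P" "rot_inv ((q + r) - (x + r)) P" using coset(1) flip by simp_all
    have "q + r \<noteq> x + r" using dist by simp
    have "q + r \<noteq> z"
    proof
      assume e: "q + r = z"
      have "x + r = q \<or> x + r = x \<or> x + r = z" using *[of x] by blast
      with d(1) Nz \<open>q + r \<noteq> x + r\<close> show False unfolding e by metis
    qed
    moreover have "x + r \<noteq> z"
    proof
      assume e: "x + r = z"
      have "q + r = q \<or> q + r = x \<or> q + r = z" using *[of q] by blast
      with d(2) Nz \<open>q + r \<noteq> x + r\<close> show False unfolding e by metis
    qed
    moreover have "q + r \<noteq> q" "x + r \<noteq> x" "z + r \<noteq> z" using rot(1) by simp_all
    ultimately have "q + r = x" "x + r = q" "z + r = q \<or> z + r = x" using *[of q] *[of x] zr by auto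
    then show False using zne by (metis add_right_cancel)
  next
    case (refl a)
    have inv: "a - t \<in> Q \<longleftrightarrow> t \<in> Q" for t using refl by (simp add: refl_inv_def)
    have *: "a - u \<in> {q, x, z}" if "u \<in> {q, x}" for u
    proof -
      have "rot_inv ((a - u) - (a - y)) P" using yx[OF that] by simp
      moreover have "a - y \<notin> P" using inv[of y] yQ by (auto simp: Q_def)
      ultimately have "a - u \<notin> P" using rot_invD by blast
      moreover have "a - u \<in> Q" using inv[of u] that by (auto simp: Q_def)
      ultimately show ?thesis by (simp add: Q_def)
    qed
    have "a - z \<notin> P"
    proof -
      have "rot_inv ((a - z) - (a - (z + h))) P" using h(2) by simp
      moreover have "a - (z + h) \<notin> P" using inv[of "z + h"] zh by (auto simp: Q_def)
      ultimately show ?thesis using rot_invD by blast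
    qed
    moreover have "a - z \<in> Q" using inv[of z] by (simp add: Q_def)
    ultimately have zr: "a - z \<in> {q, x, z}" by (simp add: Q_def)
    have d: "rot_inv ((a - x) - (a - q)) P" "rot_inv ((a - q) - (a - x)) P" using coset(1) flip by simp_all
    have "a - q \<noteq> a - x" using dist by simp
    have "a - q \<noteq> z"
    proof
      assume e: "a - q = z"
      have "a - x = q \<or> a - x = x \<or> a - x = z" using *[of x] by blast
      with d(1) Nz \<open>a - q \<noteq> a - x\<close> show False unfolding e by metis
    qed
    moreover have "a - x \<noteq> z"
    proof
      assume e: "a - x = z"
      have "a - q = q \<or> a - q = x \<or> a - q = z" using *[of q] by blast
      with d(2) Nz \<open>a - q \<noteq> a - x\<close> show False unfolding e by metis
    qed
    ultimately have aq: "a - q = q \<or> a - q = x" "a - x = q \<or> a - x = x" using *[of q] *[of x] by auto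
    have "a = q + x"
    proof (rule ccontr)
      assume "a \<noteq> q + x"
      then have "a = q + q" "a = x + x" using aq unfolding diff_eq_eq by (metis add.commute)+
      then have "q + q = x + x" by simp
      then have "x = z" using double_eq_triple[of q x z] zq zne dist by auto
      with zne show False by simp
    qed
    moreover have "a = z + q \<or> a = z + x \<or> a = z + z"
      using zr unfolding insert_iff empty_iff diff_eq_eq by (metis add.commute)
    ultimately show False using zq zne dist by (metis add.commute add_left_cancel)
  qed
qed

text \<open>The colour class is here a periodic set plus one point \<open>q\<close>. Once
  \<open>z\<close> is in the coset of \<open>q\<close> as well, \<open>sym_set_coset_part\<close>
  makes every set \<open>insert q D\<close> symmetric, so the triples through \<open>q\<close> are
  progressions and \<open>ap3_quadruple\<close> applies.\<close>

lemma ap3_if_near_rot: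
  fixes q x y z :: "'a::unique_involution"
  assumes coset: "rot_inv (x - q) P" "rot_inv (y - q) P"
    and dist: "x \<noteq> y" "x \<noteq> z" "y \<noteq> z" "x \<noteq> q" "y \<noteq> q" "z \<noteq> q"
    and out: "q \<notin> P" "x \<notin> P" "y \<notin> P" "z \<notin> P"
    and sym: "\<And>D. D \<subseteq> {x, y, z} \<Longrightarrow> sym_set (P \<union> insert q D)"
  shows "ap3 x y z"
proof -
  have P: "x - q \<noteq> 0" "rot_inv (x - q) P" using dist coset by simp_all
  have Rq: "refl_inv (q + q) P"
    using refl_inv_if_sym_insert[OF P out(1)] sym[of "{}"] by simp
  \<comment> \<open>The extensions by \<open>{}\<close> and \<open>{z}\<close> give the reflection
    at \<open>q\<close> and then equal doubles of \<open>q\<close> and \<open>z\<close>; the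
    extension by \<open>{x, z}\<close> gives the contradiction.\<close>
  have z: "rot_inv (z - q) P"
  proof (rule ccontr)
    assume N: "\<not> rot_inv (z - q) P"
    have "q + q = z + z"
      using double_eq_if_sym_insert2[OF P out(1,4) N Rq] sym[of "{z}"] by simp
    then show False
      using sym_insert3_same_coset[OF coset dist(4,5,1) out _ sym[of "{x, z}"]] N by simp
  qed
  have part: "sym_set (insert q D)" if "D \<subseteq> {x, y, z}" for D
  proof (rule sym_set_coset_part[where d = q and P = P, OF _ _ out(1) P sym[OF that]])
    show "rot_inv (u - q) P" if "u \<in> insert q D" for u
      using that \<open>D \<subseteq> {x, y, z}\<close> coset z by auto
  qed simp
  have "ap3 q x y" "ap3 q x z" "ap3 q y z"
    using sym3_imp_ap3[of q x y] sym3_imp_ap3[of q x z] sym3_imp_ap3[of q y z]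
      part[of "{x, y}"] part[of "{x, z}"] part[of "{y, z}"] dist by auto
  then show ?thesis
    using ap3_quadruple(1)[of x y z q] part[of "{x, y, z}"] dist by auto
qed

section \<open>Colour classes with an axis but no period\<close>

lemma reflection_of_insert:
  assumes a: "refl_inv a S" and nrot: "\<And>r. r \<noteq> 0 \<Longrightarrow> \<not> rot_inv r S"
    and w: "w \<notin> S" "w + w \<noteq> a" and sym: "sym_set (insert w S)"
  obtains b where "refl_inv b (insert w S)" "b \<noteq> w + w"
proof -
  have aw: "a - w \<notin> insert w S"
    using a w unfolding refl_inv_def by (auto simp: diff_eq_eq)
  from sym show ?thesis
  proof (cases rule: sym_set_cases)
    case (rot r)
    \<comment> \<open>The point \<open>w + r\<close> lies in \<open>S\<close>; reflecting it by
      \<open>a\<close> and rotating by \<open>r\<close> again lands on \<open>a - w\<close>, the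
      missing mirror image of \<open>w\<close>.\<close>
    then have "w + r \<in> insert w S" unfolding rot_inv_def by blast
    then have "w + r \<in> S" using rot(1) by simp
    then have "a - (w + r) \<in> S" using a unfolding refl_inv_def by blast
    then have "a - (w + r) + r \<in> insert w S" using rot(2) unfolding rot_inv_def by blast
    moreover have "a - (w + r) + r = a - w" by (simp add: algebra_simps)
    ultimately show ?thesis using aw by simp
  next
    case (refl b)
    \<comment> \<open>A reflection fixing \<open>w\<close> would preserve \<open>S\<close> too, and
      without periods \<open>S\<close> has only one axis, which misses \<open>w\<close>.\<close>
    have "b \<noteq> w + w"
    proof
      assume b: "b = w + w"
      have inv: "b - t \<in> insert w S \<longleftrightarrow> t \<in> insert w S" for t
        using refl unfolding refl_inv_def by blast
      have "b - t = w \<longleftrightarrow> t = w" for t unfolding b by (auto simp: diff_eq_eq)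
      then have "b - t \<in> S \<longleftrightarrow> t \<in> S" for t
        using inv[of t] w(1) by (metis insert_iff)
      then have "refl_inv b S" by (simp add: refl_inv_def)
      from refl_inv_diff[OF this a] nrot[of "b - a"] have "b = a" by auto
      with b w show False by simp
    qed
    with refl show ?thesis by (rule that)
  qed
qed

text \<open>
  Composing the reflections of \<open>S\<close> and of \<open>insert w S\<close> yields a translation that moves the
  indicator function of \<open>S\<close> only at \<open>w\<close> and its mirror image.  Comparing two such
  translations, which commute, pins down the positions of \<open>w\<close> and \<open>u\<close>
  in \<open>two_non_axis_points\<close>.
\<close>

lemma indicator_shift_diff:
  assumes a: "refl_inv a S" and b: "refl_inv b (insert w S)" and w: "w \<notin> S" "b \<noteq> w + w"
  shows "of_bool (t - (b - a) \<in> S) - of_bool (t \<in> S) = (of_bool (t = w) - of_bool (t = b - w) :: int)"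
proof -
  have "t - (b - a) = a - (b - t)" by (simp add: algebra_simps)
  then have 1: "t - (b - a) \<in> S \<longleftrightarrow> b - t \<in> S" using a unfolding refl_inv_def by metis
  have 2: "b - t \<in> insert w S \<longleftrightarrow> t \<in> insert w S" using b unfolding refl_inv_def by blast
  have 3: "b - t = w \<longleftrightarrow> t = b - w" by (auto simp: diff_eq_eq)
  have 4: "b - w \<noteq> w" using w(2) by (simp add: diff_eq_eq)
  show ?thesis using 1 2 3 4 w(1) by (cases "t = w"; cases "t = b - w") auto
qed

text \<open>The equations make \<open>b - w\<close> equal to \<open>q\<close>. By
  \<open>indicator_shift_diff\<close>, translating \<open>S\<close> by \<open>w - q\<close> then
  only adds \<open>w\<close> and removes \<open>q\<close>; taking \<open>q\<close> away from
  \<open>S\<close> leaves a set with this period.\<close>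

lemma near_rotation:
  assumes a: "refl_inv a S" and b: "refl_inv b (insert w S)" and w: "w \<notin> S" "b \<noteq> w + w"
    and q: "w - q = b - a" "q + q = a"
  shows "q \<in> S" "rot_inv (w - q) (S - {q})"
proof -
  note f = indicator_shift_diff[OF a b w, folded q(1)]
  have "b - w = q"
  proof -
    have "b = w - q + (q + q)" unfolding q by simp
    then show ?thesis by simp
  qed
  note f = f[unfolded this]
  have wq: "w \<noteq> q" using \<open>b - w = q\<close> w(2) by (auto simp: diff_eq_eq)
  show "q \<in> S" using f[of q] wq by (auto split: if_splits simp: of_bool_def)
  show "rot_inv (w - q) (S - {q})"
    unfolding rot_inv_def
  proof
    fix t
    have e: "t + (w - q) - (w - q) = t" by simp
    have 1: "t + (w - q) = w \<longleftrightarrow> t = q" by (auto simp: algebra_simps)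
    have "of_bool (t \<in> S) - of_bool (t + (w - q) \<in> S) = (of_bool (t = q) - of_bool (t + (w - q) = q) :: int)"
      using f[of "t + (w - q)"] unfolding e 1 .
    then show "t + (w - q) \<in> S - {q} \<longleftrightarrow> t \<in> S - {q}"
      using wq w(1) 1 \<open>q \<in> S\<close> by (auto simp: of_bool_def split: if_splits)
  qed
qed

lemma two_non_axis_points:
  assumes a: "refl_inv a S" and wu: "w \<noteq> u"
    and b: "refl_inv b (insert w S)" and w: "w \<notin> S" "b \<noteq> w + w"
    and c: "refl_inv c (insert u S)" and u: "u \<notin> S" "c \<noteq> u + u" "a \<noteq> u + u"
  obtains "w + u = a"
    | q where "q \<in> S" "rot_inv (w - q) (S - {q})" "rot_inv (u - q) (S - {q})"
proof -
  have "c \<noteq> a"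
  proof
    assume "c = a"
    then have "a - u \<in> insert u S" "a - u \<notin> S" using a c u(1) unfolding refl_inv_def by blast+
    then show False using u(3) by (simp add: diff_eq_eq)
  qed
  define \<rho> \<sigma> where "\<rho> = b - a" and "\<sigma> = c - a"
  have \<sigma>: "\<sigma> \<noteq> 0" using \<open>c \<noteq> a\<close> by (simp add: \<sigma>_def)
  define f g :: "'a \<Rightarrow> int" where "f = (\<lambda>t. of_bool (t = w) - of_bool (t = b - w))"
    and "g = (\<lambda>t. of_bool (t = u) - of_bool (t = c - u))"
  have f: "of_bool (t - \<rho> \<in> S) - of_bool (t \<in> S) = f t" for t
    using indicator_shift_diff[OF a b w(1,2)] by (simp add: f_def \<rho>_def)
  have g: "of_bool (t - \<sigma> \<in> S) - of_bool (t \<in> S) = g t" for t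
    using indicator_shift_diff[OF a c u(1,2)] by (simp add: g_def \<sigma>_def)
  \<comment> \<open>Both sides are the mixed second difference of the indicator function of
    \<open>S\<close>.\<close>
  have cross: "f (t - \<sigma>) - f t = g (t - \<rho>) - g t" for t
  proof -
    have e: "t - \<sigma> - \<rho> = t - \<rho> - \<sigma>" by (simp add: algebra_simps)
    show ?thesis unfolding f[symmetric] g[symmetric] e by linarith
  qed
  have bw: "w \<noteq> b - w" using w(2) by (metis diff_add_cancel)
  \<comment> \<open>At \<open>t = w\<close> the left side of \<open>cross\<close> is at most -1.
    Since \<open>g w \<le> 0\<close>, the value \<open>g (w - \<rho>)\<close> must be negative,
    which happens only at \<open>c - u\<close>.\<close>
  have 1: "w - \<rho> = c - u"
  proof (rule ccontr)
    assume "w - \<rho> \<noteq> c - u"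
    then have "g (w - \<rho>) \<ge> 0" "g w \<le> 0" using wu by (simp_all add: g_def)
    moreover have "f (w - \<sigma>) \<le> 0" "f w = 1" using \<sigma> bw by (simp_all add: f_def)
    ultimately show False using cross[of w] by simp
  qed
  \<comment> \<open>At \<open>t = w + \<sigma>\<close> the left side of \<open>cross\<close> is at
    least 1, so the first \<open>g\<close> value is positive or the second one is negative.\<close>
  have 2: "w + \<sigma> - \<rho> = u \<or> w + \<sigma> = c - u"
  proof (rule ccontr)
    assume "\<not> ?thesis"
    then have "g (w + \<sigma> - \<rho>) \<le> 0" "g (w + \<sigma>) \<ge> 0" by (simp_all add: g_def)
    moreover have "f (w + \<sigma>) \<le> 0" "f w = 1" using \<sigma> bw by (simp_all add: f_def)
    ultimately show False using cross[of "w + \<sigma>"] by simp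
  qed
  show ?thesis
  proof (cases "w + \<sigma> = c - u")
    case True
    then have "w + (c - a) + u = c" unfolding \<sigma>_def by (metis diff_add_cancel)
    moreover have "w + (c - a) + u = (w + u) + (c - a)" by (simp add: algebra_simps)
    moreover have "c = a + (c - a)" by simp
    ultimately have "w + u = a" by (metis add_right_cancel)
    then show ?thesis by (rule that(1))
  next
    case False
    with 2 have u: "u = w + \<sigma> - \<rho>" by simp
    \<comment> \<open>Now \<open>w = q + \<rho>\<close> and \<open>u = q + \<sigma>\<close>, while
      the first equation reads \<open>q = c - u\<close>; hence \<open>q\<close> lies on the axis of
      \<open>S\<close>.\<close>
    define q where "q = w - \<rho>"
    have wq: "w - q = b - a" by (simp add: q_def \<rho>_def)
    have uq: "u - q = c - a" by (simp add: q_def u \<sigma>_def)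
    have "q + q = (c - u) + q" using 1 by (simp add: q_def)
    also have "\<dots> = c - (u - q)" by simp
    finally have qq: "q + q = a" unfolding uq by simp
    show ?thesis
      using near_rotation[OF a b w(1,2) wq qq] near_rotation[OF a c \<open>u \<notin> S\<close> \<open>c \<noteq> u + u\<close> uq qq] that(2) by blast
  qed
qed


lemma reflection_fixes_two:
  fixes x y z :: "'a::unique_involution"
  assumes dist: "x \<noteq> y" "x \<noteq> z" "y \<noteq> z" and nap: "\<not> ap3 x y z"
    and out: "x \<notin> S" "y \<notin> S" "z \<notin> S"
    and sym: "\<And>D. D \<subseteq> {x, y, z} \<Longrightarrow> sym_set (S \<union> D)"
  obtains a where "refl_inv a S" "(x + x = a \<and> y + y = a) \<or> (x + x = a \<and> z + z = a) \<or> (y + y = a \<and> z + z = a)"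
proof -
  \<comment> \<open>A period of \<open>S\<close> would already force a progression, so the symmetry
    of \<open>S\<close> is a reflection.\<close>
  have nrot: "\<not> rot_inv r S" if "r \<noteq> 0" for r
    using ap3_if_rot[OF that _ dist out sym] nap by blast
  then obtain a where a: "refl_inv a S"
    using sym[of "{}"] by (auto simp: sym_set_def)
  have pair: "w + u = a"
    if perm: "{w, u, v} = {x, y, z}" and wuv: "w \<noteq> u" "w \<noteq> v" "u \<noteq> v" "w + w \<noteq> a" "u + u \<noteq> a"
      and nap': "\<not> ap3 w u v" for w u v
  proof -
    have wuvS: "w \<notin> S" "u \<notin> S" "v \<notin> S" using out perm by auto
    have sub: "{w} \<subseteq> {x, y, z}" "{u} \<subseteq> {x, y, z}" using perm by auto
    obtain b where b: "refl_inv b (insert w S)" "b \<noteq> w + w"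
      using reflection_of_insert[OF a nrot wuvS(1) wuv(4)] sym[OF sub(1)] by auto
    obtain c where c: "refl_inv c (insert u S)" "c \<noteq> u + u"
      using reflection_of_insert[OF a nrot wuvS(2) wuv(5)] sym[OF sub(2)] by auto
    show ?thesis
    proof (rule two_non_axis_points[OF a wuv(1) b(1) wuvS(1) b(2) c(1) wuvS(2) c(2) wuv(5)[symmetric]])
      fix q assume q: "q \<in> S" "rot_inv (w - q) (S - {q})" "rot_inv (u - q) (S - {q})"
      \<comment> \<open>\<open>S\<close> is the periodic set \<open>S - {q}\<close> together with
        \<open>q\<close>, the situation of \<open>ap3_if_near_rot\<close>.\<close>
      have "ap3 w u v"
      proof (rule ap3_if_near_rot[OF q(2,3) wuv(1-3)])
        fix D assume "D \<subseteq> {w, u, v}"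
        moreover have "S - {q} \<union> insert q D = S \<union> D" using q(1) by auto
        ultimately show "sym_set (S - {q} \<union> insert q D)" using sym perm by simp
      qed (use wuvS q(1) in auto)
      with nap' show ?thesis by blast
    qed
  qed
  have xy: "x + y = a" if "x + x \<noteq> a" "y + y \<noteq> a"
    using pair[of x y z] dist nap that by simp
  have xz: "x + z = a" if "x + x \<noteq> a" "z + z \<noteq> a"
    using pair[of x z y] dist nap that ap3_commute(2)[of x y z] by (simp add: insert_commute)
  have yz: "y + z = a" if "y + y \<noteq> a" "z + z \<noteq> a"
    using pair[of y z x] dist nap that ap3_commute(1)[of x y z] ap3_commute(2)[of y x z] by (simp add: insert_commute)
  \<comment> \<open>With no point on the axis, \<open>x + y = x + z\<close> would identify two
    points. With exactly one on it, that point would be the midpoint of the other two.\<close>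
  have "(x + x = a \<and> y + y = a) \<or> (x + x = a \<and> z + z = a) \<or> (y + y = a \<and> z + z = a)"
    using xy xz yz nap dist unfolding ap3_def by (metis add.commute add_left_cancel)
  with a show ?thesis by (rule that)
qed

text \<open>
  Both \<open>S\<close> and the complement of \<open>S \<union> {x, y, z}\<close> have an axis through two of the three points.
  Only one pair of points has equal doubles, so the two axes agree, and then
  the third point is fixed as well.
\<close>

theorem ap3_if_all_extensions_symmetric:
  fixes x y z :: "'a::unique_involution"
  assumes dist: "x \<noteq> y" "x \<noteq> z" "y \<noteq> z"
    and out: "x \<notin> S" "y \<notin> S" "z \<notin> S"
    and sym: "\<And>D. D \<subseteq> {x, y, z} \<Longrightarrow> sym_set (S \<union> D)"
  shows "ap3 x y z"
proof (rule ccontr)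
  assume nap: "\<not> ap3 x y z"
  obtain a where a: "refl_inv a S"
    and a2: "(x + x = a \<and> y + y = a) \<or> (x + x = a \<and> z + z = a) \<or> (y + y = a \<and> z + z = a)"
    using reflection_fixes_two[OF dist nap out sym] by blast
  define S' where "S' = - (S \<union> {x, y, z})"
  have "sym_set (S' \<union> D)" if "D \<subseteq> {x, y, z}" for D
  proof -
    have "S' \<union> D = - (S \<union> ({x, y, z} - D))" using that out by (auto simp: S'_def)
    moreover have "sym_set (S \<union> ({x, y, z} - D))" using sym[of "{x, y, z} - D"] by blast
    ultimately show ?thesis by (simp only: sym_set_Compl)
  qed
  moreover have "x \<notin> S'" "y \<notin> S'" "z \<notin> S'" by (simp_all add: S'_def)
  ultimately obtain b where b: "refl_inv b S'"
    and b2: "(x + x = b \<and> y + y = b) \<or> (x + x = b \<and> z + z = b) \<or> (y + y = b \<and> z + z = b)"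
    using reflection_fixes_two[OF dist nap, of S'] by blast
  have no3: "\<not> (x + x = a \<and> y + y = a \<and> z + z = a)"
    using double_eq_triple[of x y z] dist by metis
  have "a = b"
    using a2 b2 no3 double_eq_triple[of x y z] double_eq_triple[of y x z] double_eq_triple[of z x y] dist by metis
  \<comment> \<open>Here \<open>v\<close> is the point off the common axis. Its mirror image avoids
    \<open>S\<close> and \<open>S'\<close>, so it is one of the other two points; these are fixed by
    the reflection, so \<open>v\<close> would be fixed as well.\<close>
  have fin: False if "v \<notin> S" "v \<in> {x, y, z}" "v + v \<noteq> a" "\<And>u. u \<in> {x, y, z} \<Longrightarrow> u = v \<or> u + u = a" for v
  proof -
    have "a - v \<notin> S" using a that unfolding refl_inv_def by blast
    moreover have "a - v \<notin> S'"
      using b that unfolding \<open>a = b\<close> refl_inv_def by (auto simp: S'_def)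
    ultimately have "a - v \<in> {x, y, z}" by (simp add: S'_def)
    then have "a - v = v \<or> (a - v) + (a - v) = a" using that(4) by blast
    moreover have "a - v \<noteq> v" using that(3) by (metis diff_add_cancel)
    ultimately show False by simp
  qed
  show False
    using a2 no3 fin[of x] fin[of y] fin[of z] out by blast
qed

subsection \<open>The circle\<close>

lemma circle_iff: "z \<in> circle \<longleftrightarrow> cmod z = 1"
  by (simp add: circle_def)

text \<open>Complex multiplication on the circle is written additively, so that the results on
  abelian groups apply through the type class.\<close>

typedef unit_circle = circle
  by (rule exI[of _ 1]) (simp add: circle_iff)

lemma norm_Rep [simp]: "cmod (Rep_unit_circle u) = 1"
  using Rep_unit_circle[of u] by (simp add: circle_iff)

lemma Rep_nonzero [simp]: "Rep_unit_circle u \<noteq> 0"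
  using norm_Rep[of u] by force

instantiation unit_circle :: ab_group_add
begin

definition "0 = Abs_unit_circle 1"
definition "u + v = Abs_unit_circle (Rep_unit_circle u * Rep_unit_circle v)"
definition "- u = Abs_unit_circle (inverse (Rep_unit_circle u))"
definition "u - v = Abs_unit_circle (Rep_unit_circle u / Rep_unit_circle v)"

lemma Rep_zero: "Rep_unit_circle 0 = 1"
  and Rep_plus: "Rep_unit_circle (u + v) = Rep_unit_circle u * Rep_unit_circle v"
  and Rep_uminus: "Rep_unit_circle (- u) = inverse (Rep_unit_circle u)"
  and Rep_minus: "Rep_unit_circle (u - v) = Rep_unit_circle u / Rep_unit_circle v"
  unfolding zero_unit_circle_def plus_unit_circle_def uminus_unit_circle_def minus_unit_circle_def
  by (simp_all add: Abs_unit_circle_inverse circle_iff norm_mult norm_inverse norm_divide)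

instance
  by standard
    (simp_all add: Rep_unit_circle_inject[symmetric] Rep_zero Rep_plus Rep_uminus Rep_minus divide_inverse)

end

instance unit_circle :: unique_involution
proof
  fix u v :: unit_circle
  assume "u + u = 0" "v + v = 0" "u \<noteq> 0" "v \<noteq> 0"
  then have "Rep_unit_circle u * Rep_unit_circle u = 1" "Rep_unit_circle v * Rep_unit_circle v = 1"
    "Rep_unit_circle u \<noteq> 1" "Rep_unit_circle v \<noteq> 1"
    by (metis Rep_plus Rep_zero Rep_unit_circle_inject)+
  then have "Rep_unit_circle u = Rep_unit_circle v" unfolding square_eq_1_iff by simp
  then show "u = v" by (simp add: Rep_unit_circle_inject)
qed

lemma torsion_unit_circle: "torsion k u \<longleftrightarrow> Rep_unit_circle u ^ k = 1"
proof -
  have "Rep_unit_circle (((+) u ^^ k) 0) = Rep_unit_circle u ^ k"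
    by (induction k) (simp_all add: Rep_zero Rep_plus)
  then show ?thesis unfolding torsion_def by (metis Rep_unit_circle_inject Rep_zero)
qed

section \<open>Isometries as translations and reflections of the group\<close>

lemma rotation_in_O2: "cmod \<alpha> = 1 \<Longrightarrow> (\<lambda>z. \<alpha> * z) \<in> O2"
  and reflection_in_O2: "cmod \<alpha> = 1 \<Longrightarrow> (\<lambda>z. \<alpha> * cnj z) \<in> O2"
  unfolding O2_def orthogonal_transformation
  by (auto simp: norm_mult algebra_simps intro!: linearI)

text \<open>A linear map is determined by the images \<open>\<alpha>\<close> of 1 and
  \<open>\<beta>\<close> of \<open>\<i>\<close>, here orthogonal unit vectors. The real part of
  \<open>\<beta> * cnj \<alpha>\<close> is their inner product 0, so this number is
  \<open>\<i>\<close> or \<open>- \<i>\<close>.\<close>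

lemma O2_cases:
  assumes "g \<in> O2"
  obtains \<alpha> where "cmod \<alpha> = 1" "g = (\<lambda>z. \<alpha> * z)" | \<alpha> where "cmod \<alpha> = 1" "g = (\<lambda>z. \<alpha> * cnj z)"
proof -
  have g: "orthogonal_transformation g" using assms by (simp add: O2_def)
  have lin: "linear g" and nrm: "\<And>v. cmod (g v) = cmod v"
    using g unfolding orthogonal_transformation by blast+
  define \<alpha> \<beta> \<gamma> where "\<alpha> = g 1" and "\<beta> = g \<i>" and "\<gamma> = \<beta> * cnj \<alpha>"
  have \<alpha>: "cmod \<alpha> = 1" and \<beta>: "cmod \<beta> = 1" using nrm by (simp_all add: \<alpha>_def \<beta>_def)
  have gz: "g z = of_real (Re z) * \<alpha> + of_real (Im z) * \<beta>" for z
  proof -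
    have "z = Re z *\<^sub>R 1 + Im z *\<^sub>R \<i>" by (simp add: complex_eq_iff)
    then have "g z = g (Re z *\<^sub>R 1 + Im z *\<^sub>R \<i>)" by simp
    also have "\<dots> = Re z *\<^sub>R \<alpha> + Im z *\<^sub>R \<beta>"
      unfolding linear_add[OF lin] linear_cmul[OF lin] \<alpha>_def \<beta>_def ..
    finally show ?thesis by (simp add: scaleR_conv_of_real)
  qed
  have "\<alpha> \<bullet> \<beta> = 1 \<bullet> \<i>"
    using g unfolding orthogonal_transformation_def \<alpha>_def \<beta>_def by blast
  then have "Re \<gamma> = 0" by (simp add: \<gamma>_def inner_complex_def algebra_simps)
  moreover have "cmod \<gamma> = 1" by (simp add: \<gamma>_def norm_mult \<alpha> \<beta>)
  ultimately have "\<bar>Im \<gamma>\<bar> = 1" by (simp add: cmod_def)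
  then have \<gamma>: "\<gamma> = \<i> \<or> \<gamma> = - \<i>" using \<open>Re \<gamma> = 0\<close> by (auto simp: complex_eq_iff)
  have "cnj \<alpha> * \<alpha> = 1" using \<alpha> by (simp add: complex_norm_square[symmetric] mult.commute)
  then have "\<beta> = \<gamma> * \<alpha>" by (simp add: \<gamma>_def)
  with \<gamma> have "\<beta> = \<i> * \<alpha> \<or> \<beta> = - \<i> * \<alpha>" by auto
  then show ?thesis
  proof
    assume "\<beta> = \<i> * \<alpha>"
    then have "g z = \<alpha> * z" for z
      by (subst (2) complex_eq[of z]) (simp add: gz algebra_simps)
    with \<alpha> that(1) show ?thesis by blast
  next
    assume "\<beta> = - \<i> * \<alpha>"
    then have "g z = \<alpha> * cnj z" for z
      unfolding gz by (simp add: complex_eq_iff algebra_simps)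
    with \<alpha> that(2) show ?thesis by blast
  qed
qed

text \<open>On the circle \<open>cnj z\<close> is the inverse of \<open>z\<close>, so
  \<open>z \<mapsto> \<alpha> * cnj z\<close> becomes a map
  \<open>u \<mapsto> a - u\<close>.\<close>

lemma sym_set_if_not_distinguishing:
  assumes "\<not> distinguishing circle O2 c"
  shows "sym_set {u. c (Rep_unit_circle u)}"
proof -
  obtain g x where g: "g \<in> O2" and inv: "\<And>z. z \<in> circle \<Longrightarrow> c (g z) = c z" and x: "x \<in> circle" "g x \<noteq> x"
    using assms unfolding distinguishing_def by blast
  have cR: "c (g (Rep_unit_circle u)) = c (Rep_unit_circle u)" for u
    by (rule inv) (simp add: circle_iff)
  from g show ?thesis
  proof (cases rule: O2_cases)
    case (1 \<alpha>)
    define r where "r = Abs_unit_circle \<alpha>"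
    have r: "Rep_unit_circle r = \<alpha>" using 1 by (simp add: r_def Abs_unit_circle_inverse circle_iff)
    have "r \<noteq> 0" using r x 1 by (auto simp: Rep_zero)
    moreover have "rot_inv r {u. c (Rep_unit_circle u)}"
      using cR 1 by (simp add: rot_inv_def Rep_plus r mult.commute)
    ultimately show ?thesis unfolding sym_set_def by blast
  next
    case (2 \<alpha>)
    define a where "a = Abs_unit_circle \<alpha>"
    have a: "Rep_unit_circle a = \<alpha>" using 2 by (simp add: a_def Abs_unit_circle_inverse circle_iff)
    have "\<alpha> / Rep_unit_circle u = g (Rep_unit_circle u)" for u
      using complex_div_cnj[of \<alpha> "Rep_unit_circle u"] by (simp add: 2)
    then have "refl_inv a {u. c (Rep_unit_circle u)}"
      using cR by (simp add: refl_inv_def Rep_minus a)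
    then show ?thesis unfolding sym_set_def by blast
  qed
qed

section \<open>Upper bound for the circle\<close>

lemma ap3_if_not_precol_ext:
  assumes W: "\<not> precol_ext circle O2 W" and xyz: "Rep_unit_circle x \<in> W" "Rep_unit_circle y \<in> W" "Rep_unit_circle z \<in> W"
    and dist: "x \<noteq> y" "x \<noteq> z" "y \<noteq> z"
  shows "ap3 x y z"
proof -
  obtain c0 where c0: "\<not> (\<exists>c. (\<forall>v\<in>circle - W. c v = c0 v) \<and> distinguishing circle O2 c)"
    using W unfolding precol_ext_def not_all by (rule exE)
  \<comment> \<open>The remaining points of \<open>W\<close> keep their colour under
    \<open>c0\<close>; only the triple is recoloured, so each \<open>S \<union> D\<close> is the
    colour class of an extension.\<close>
  define S where "S = {u. c0 (Rep_unit_circle u)} - {x, y, z}"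
  show ?thesis
  proof (rule ap3_if_all_extensions_symmetric[OF dist])
    fix D assume D: "D \<subseteq> {x, y, z}"
    define c where "c = (\<lambda>v. v \<in> Rep_unit_circle ` (S \<union> D))"
    have "\<forall>v\<in>circle - W. c v = c0 v"
    proof
      fix v assume v: "v \<in> circle - W"
      then obtain u where u: "v = Rep_unit_circle u" using Rep_unit_circle_cases by blast
      then have "u \<notin> {x, y, z}" using v xyz by auto
      then show "c v = c0 v"
        using D unfolding c_def S_def u by (auto simp: Rep_unit_circle_inject image_iff)
    qed
    with c0 have "\<not> distinguishing circle O2 c" by metis
    from sym_set_if_not_distinguishing[OF this] show "sym_set (S \<union> D)"
      by (simp add: c_def Rep_unit_circle_inject image_iff Un_def)
  qed (simp_all add: S_def)
qed

text \<open>Any two points of \<open>W\<close> other than \<open>q\<close> form, with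
  \<open>q\<close> and a fourth point, a quadruple of progressions, so their quotients by
  \<open>q\<close> are both fourth or both fifth roots of unity. Hence a point violating the first
  alternative and one violating the second cannot coexist.\<close>

lemma powers_if_not_precol_ext:
  assumes circ: "W \<subseteq> circle" and W: "\<not> precol_ext circle O2 W" and q: "q \<in> W"
    and card: "infinite W \<or> 4 \<le> card W"
  shows "(\<forall>x\<in>W. x ^ 4 = q ^ 4) \<or> (\<forall>x\<in>W. x ^ 5 = q ^ 5)"
proof -
  have q0: "v \<noteq> 0" if "v \<in> W" for v using that circ by (auto simp: circle_iff)
  have pair: "(x ^ 4 = q ^ 4 \<and> y ^ 4 = q ^ 4) \<or> (x ^ 5 = q ^ 5 \<and> y ^ 5 = q ^ 5)"
    if xy: "x \<in> W" "y \<in> W" "x \<noteq> y" "x \<noteq> q" "y \<noteq> q" for x y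
  proof -
    have "\<not> W \<subseteq> {q, x, y}"
    proof
      assume sub: "W \<subseteq> {q, x, y}"
      then have "finite W" by (rule finite_subset) simp
      moreover have "card W \<le> 3" using card_mono[OF _ sub] xy by (simp add: card_insert_if)
      ultimately show False using card by simp
    qed
    then obtain z where z: "z \<in> W" "z \<noteq> q" "z \<noteq> x" "z \<noteq> y" by blast
    define A where "A = Abs_unit_circle"
    have R: "Rep_unit_circle (A v) = v" if "v \<in> W" for v
      using circ that by (auto simp: A_def Abs_unit_circle_inverse)
    have neq: "A u \<noteq> A v" if "u \<in> W" "v \<in> W" "u \<noteq> v" for u v
      using R that by metis
    have ap: "ap3 (A u) (A v) (A w)" if "u \<in> W" "v \<in> W" "w \<in> W" "u \<noteq> v" "u \<noteq> w" "v \<noteq> w" for u v w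
      using ap3_if_not_precol_ext[OF W] R neq that by simp
    have "(torsion 4 (A x - A q) \<and> torsion 4 (A y - A q) \<and> torsion 4 (A z - A q))
      \<or> (torsion 5 (A x - A q) \<and> torsion 5 (A y - A q) \<and> torsion 5 (A z - A q))"
      by (rule ap3_quadruple(2)) (use ap neq q xy z in auto)
    then show ?thesis
      using xy q q0[OF q] by (auto simp: torsion_unit_circle Rep_minus R power_divide)
  qed
  have excl: "x = q" if "x \<in> W" "x ^ 4 = q ^ 4" "x ^ 5 = q ^ 5" for x
  proof -
    have "q ^ 4 * x = x ^ 5" using that(2) by (simp add: eval_nat_numeral)
    also have "\<dots> = q ^ 4 * q" using that(3) by (simp add: eval_nat_numeral)
    finally show ?thesis using q0[OF q] by simp
  qed
  show ?thesis
  proof (rule ccontr)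
    assume "\<not> ?thesis"
    then obtain x y where x: "x \<in> W" "x ^ 4 \<noteq> q ^ 4" and y: "y \<in> W" "y ^ 5 \<noteq> q ^ 5" by blast
    show False
    proof (cases "x = y")
      \<comment> \<open>One point violating both alternatives is paired with a third point of
        \<open>W\<close>.\<close>
      case True
      have "x \<noteq> q" using x by auto
      have "\<not> W \<subseteq> {q, x}"
      proof
        assume sub: "W \<subseteq> {q, x}"
        then have "finite W" by (rule finite_subset) simp
        moreover have "card W \<le> 2" using card_mono[OF _ sub] \<open>x \<noteq> q\<close> by (simp add: card_insert_if)
        ultimately show False using card by simp
      qed
      then obtain z where "z \<in> W" "z \<noteq> q" "z \<noteq> x" by blast
      then show False using pair[of x z] x y True \<open>x \<noteq> q\<close> by auto
    next
      case False
      then show False using pair[of x y] x y by auto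
    qed
  qed
qed

lemma card_le_if_powers:
  fixes q :: complex
  assumes "\<forall>x\<in>W. x ^ k = q ^ k" "q \<noteq> 0" "k > 0"
  shows "finite W" "card W \<le> k"
proof -
  have sub: "W \<subseteq> {x. x ^ k = q ^ k}" using assms(1) by blast
  have fin: "finite {x. x ^ k = q ^ k}" using assms(3) by (simp add: finite_nth_roots)
  show "finite W" using sub fin by (rule finite_subset)
  show "card W \<le> k" using card_mono[OF fin sub] card_nth_roots[of "q ^ k" k] assms by simp
qed

lemma ext_good_circle: "ext_good circle O2 6"
  unfolding ext_good_def
proof (intro allI impI)
  fix W :: "complex set"
  assume W: "W \<subseteq> circle" "infinite W \<or> 6 \<le> card W"
  show "precol_ext circle O2 W"
  proof (rule ccontr)
    assume no: "\<not> precol_ext circle O2 W"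
    have "W \<noteq> {}" using W(2) by auto
    then obtain q where q: "q \<in> W" by blast
    have q0: "q \<noteq> 0" using q W(1) by (auto simp: circle_iff)
    have "infinite W \<or> 4 \<le> card W" using W(2) by auto
    from powers_if_not_precol_ext[OF W(1) no q this]
    show False
      using card_le_if_powers[of W 4 q] card_le_if_powers[of W 5 q] q0 W(2) by auto
  qed
qed

subsection \<open>The cycle inside the circle\<close>

definition vtx :: "nat \<Rightarrow> nat \<Rightarrow> complex" where
  "vtx n i = cis (2 * pi * real i / real n)"

lemma norm_vtx [simp]: "cmod (vtx n i) = 1" by (simp add: vtx_def)

lemma vtx_nonzero [simp]: "vtx n i \<noteq> 0"
  using norm_vtx[of n i] by force

lemma vtx_0 [simp]: "vtx n 0 = 1" by (simp add: vtx_def)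

lemma vtx_add: "vtx n (i + j) = vtx n i * vtx n j"
  by (simp add: vtx_def cis_mult add_divide_distrib distrib_left)

lemma vtx_n: "n > 0 \<Longrightarrow> vtx n n = 1" by (simp add: vtx_def)

lemma vtx_mult: "vtx n (i * j) = vtx n i ^ j"
  by (induction j) (simp_all add: vtx_add mult.commute)

lemma vtx_mod: "n > 0 \<Longrightarrow> vtx n (i mod n) = vtx n i"
proof -
  assume "n > 0"
  have "vtx n i = vtx n (n * (i div n) + i mod n)" by simp
  also have "\<dots> = vtx n (i mod n)" unfolding vtx_add vtx_mult by (simp add: vtx_n \<open>n > 0\<close>)
  finally show ?thesis by simp
qed

lemma vtx_power_n: "n > 0 \<Longrightarrow> vtx n i ^ n = 1"
  unfolding vtx_mult[symmetric] by (subst mult.commute) (simp add: vtx_mult vtx_n)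

lemma inj_vtx: "n > 0 \<Longrightarrow> inj_on (vtx n) {0..<n}"
  using Complex.bij_betw_roots_unity[of n] unfolding vtx_def bij_betw_def by (simp add: lessThan_atLeast0)

lemma vtx_eq_iff: "i < n \<Longrightarrow> j < n \<Longrightarrow> vtx n i = vtx n j \<longleftrightarrow> i = j"
  using inj_onD[OF inj_vtx[of n]] by auto

lemma vtx_eq_1_iff:
  assumes "n > 0"
  shows "vtx n i = 1 \<longleftrightarrow> n dvd i"
  using vtx_eq_iff[of "i mod n" n 0] assms by (simp add: vtx_mod mod_eq_0_iff_dvd)

lemma vtx_adj:
  assumes "cycle_adj n i j" "n > 0"
  shows "vtx n j = vtx n i * vtx n 1 \<or> vtx n i = vtx n j * vtx n 1"
proof -
  have "vtx n (Suc k mod n) = vtx n k * vtx n 1" for k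
    using vtx_add[of n k 1] assms(2) by (simp add: vtx_mod)
  then show ?thesis using assms(1) unfolding cycle_adj_def by auto
qed

text \<open>An injective walk with steps \<open>\<omega>\<close> and \<open>inverse \<omega>\<close>
  cannot turn back, because it would revisit the point before the last; so its first step fixes the
  direction.\<close>

lemma geometric_if_adjacent:
  assumes inj: "inj_on E {0..<n}" and \<omega>: "\<omega> \<noteq> 0"
    and adj: "\<And>i. Suc i < n \<Longrightarrow> E (Suc i) = E i * \<omega> \<or> E i = E (Suc i) * \<omega>"
    and start: "E 1 = E 0 * \<omega>" and i: "i < n"
  shows "E i = E 0 * (\<omega> ^ i :: complex)"
proof -
  \<comment> \<open>Two consecutive terms are carried along, since excluding a turn requires the
    previous one.\<close>
  have "Suc i < n \<Longrightarrow> E i = E 0 * \<omega> ^ i \<and> E (Suc i) = E 0 * \<omega> ^ Suc i" for i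
  proof (induction i)
    case 0
    then show ?case using start by simp
  next
    case (Suc i)
    then have IH: "E i = E 0 * \<omega> ^ i" "E (Suc i) = E 0 * \<omega> ^ Suc i" by simp_all
    have "E (Suc i) \<noteq> E (Suc (Suc i)) * \<omega>"
    proof
      assume "E (Suc i) = E (Suc (Suc i)) * \<omega>"
      then have "E (Suc (Suc i)) * \<omega> = E i * \<omega>" unfolding IH by (auto simp: ac_simps)
      then have "E (Suc (Suc i)) = E i" using \<omega> by simp
      then show False using inj_onD[OF inj, of "Suc (Suc i)" i] Suc.prems by simp
    qed
    then show ?case using adj[OF Suc.prems] IH by simp
  qed
  from this[of "i - 1"] i show ?thesis by (cases i) auto
qed

text \<open>The images of the vertices form an injective walk around the cycle. The first step is
  \<open>\<omega>\<close> or its inverse, which gives a rotation or a reflection.\<close>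

lemma cycle_aut_vtx:
  assumes n: "n \<ge> 3" and g: "g \<in> cycle_aut n"
  obtains "\<And>i. i < n \<Longrightarrow> vtx n (g i) = vtx n (g 0) * vtx n i"
    | "\<And>i. i < n \<Longrightarrow> vtx n (g i) = vtx n (g 0) * cnj (vtx n i)"
proof -
  have bij: "bij_betw g {0..<n} {0..<n}" using g by (simp add: cycle_aut_def)
  define E where "E = (\<lambda>i. vtx n (g i))"
  define \<omega> where "\<omega> = vtx n 1"
  have \<omega>: "\<omega> \<noteq> 0" "inverse \<omega> \<noteq> 0" by (simp_all add: \<omega>_def)
  have inj: "inj_on E {0..<n}"
    unfolding E_def using comp_inj_on[of g "{0..<n}" "vtx n"] bij inj_vtx[of n] n
    by (simp add: bij_betw_def comp_def)
  have adj: "E (Suc i) = E i * \<omega> \<or> E i = E (Suc i) * \<omega>" if "Suc i < n" for i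
  proof -
    have "cycle_adj n i (Suc i)" using that by (simp add: cycle_adj_def)
    then have "cycle_adj n (g i) (g (Suc i))" using g that by (simp add: cycle_aut_def)
    then show ?thesis using vtx_adj[of n] n by (simp add: E_def \<omega>_def)
  qed
  have pow: "vtx n i = \<omega> ^ i" for i using vtx_mult[of n 1 i] by (simp add: \<omega>_def)
  have "E 1 = E 0 * \<omega> \<or> E 0 = E 1 * \<omega>" using adj[of 0] n by simp
  then show ?thesis
  proof
    assume start: "E 1 = E 0 * \<omega>"
    have "vtx n (g i) = vtx n (g 0) * vtx n i" if "i < n" for i
      using geometric_if_adjacent[OF inj \<omega>(1) adj start that] unfolding E_def pow[symmetric] .
    then show ?thesis by (rule that(1))
  next
    assume "E 0 = E 1 * \<omega>"
    then have start: "E 1 = E 0 * inverse \<omega>" using \<omega> by simp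
    have adj': "E (Suc i) = E i * inverse \<omega> \<or> E i = E (Suc i) * inverse \<omega>" if "Suc i < n" for i
      using adj[OF that] \<omega>(1) by (metis mult.assoc mult.right_neutral right_inverse)
    have "inverse \<omega> = cnj \<omega>" by (simp add: \<omega>_def vtx_def cis_cnj)
    then have inv: "inverse \<omega> ^ i = cnj (vtx n i)" for i by (simp add: pow)
    have "vtx n (g i) = vtx n (g 0) * cnj (vtx n i)" if "i < n" for i
      using geometric_if_adjacent[OF inj \<omega>(2) adj' start that] unfolding E_def inv .
    then show ?thesis by (rule that(2))
  qed
qed

text \<open>
  Colour the circle constantly away from the \<open>n\<close>-th roots of unity: every automorphism of the
  cycle extends to an isometry of the circle that respects this colouring.
\<close>

lemma precol_ext_cycle_if_circle:
  assumes n: "n \<ge> 3" and W: "W \<subseteq> {0..<n}" and ext: "precol_ext circle O2 (vtx n ` W)"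
  shows "precol_ext {0..<n} (cycle_aut n) W"
  unfolding precol_ext_def
proof
  fix c0 :: "nat \<Rightarrow> bool"
  define C0 where "C0 = (\<lambda>z. \<exists>i<n. z = vtx n i \<and> c0 i)"
  obtain C where C: "\<forall>z\<in>circle - vtx n ` W. C z = C0 z" and dist: "distinguishing circle O2 C"
    using ext unfolding precol_ext_def by metis
  define c where "c = (\<lambda>i. C (vtx n i))"
  have "c i = c0 i" if "i \<in> {0..<n} - W" for i
  proof -
    have "vtx n i \<notin> vtx n ` W"
    proof
      assume "vtx n i \<in> vtx n ` W"
      then obtain j where j: "j \<in> W" "vtx n i = vtx n j" by blast
      then have "j < n" using W by auto
      then have "i = j" using vtx_eq_iff[of i n j] j that by simp
      then show False using j that by simp
    qed
    then have "c i = C0 (vtx n i)" using C by (simp add: c_def circle_iff)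
    also have "\<dots> = c0 i" using that by (auto simp: C0_def vtx_eq_iff)
    finally show ?thesis .
  qed
  moreover have "distinguishing {0..<n} (cycle_aut n) c"
    unfolding distinguishing_def
  proof (intro ballI impI)
    fix g i
    assume g: "g \<in> cycle_aut n" and inv: "\<forall>x\<in>{0..<n}. c (g x) = c x" and i: "i \<in> {0..<n}"
    have bij: "bij_betw g {0..<n} {0..<n}" using g by (simp add: cycle_aut_def)
    have gn: "g i < n" if "i < n" for i using bij_betwE[OF bij] that by simp
    obtain G where G: "G \<in> O2" "\<And>i. i < n \<Longrightarrow> G (vtx n i) = vtx n (g i)" and GC: "G ` circle \<subseteq> circle" and Ginj: "inj G"
    proof (cases rule: cycle_aut_vtx[OF n g])
      case 1
      show ?thesis
      proof (rule that)
        show "(\<lambda>z. vtx n (g 0) * z) \<in> O2" by (rule rotation_in_O2) simp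
        show "vtx n (g 0) * vtx n i = vtx n (g i)" if "i < n" for i using 1[OF that] by (rule sym)
      qed (auto simp: circle_iff norm_mult inj_on_def)
    next
      case 2
      show ?thesis
      proof (rule that)
        show "(\<lambda>z. vtx n (g 0) * cnj z) \<in> O2" by (rule reflection_in_O2) simp
        show "vtx n (g 0) * cnj (vtx n i) = vtx n (g i)" if "i < n" for i using 2[OF that] by (rule sym)
      qed (auto simp: circle_iff norm_mult inj_on_def)
    qed
    have "C (G z) = C z" if z: "z \<in> circle" for z
    proof (cases "z \<in> vtx n ` {0..<n}")
      case True
      then obtain j where j: "j < n" "z = vtx n j" by auto
      then show ?thesis using G(2)[of j] inv by (simp add: c_def)
    next
      case False
      have "G z \<notin> vtx n ` {0..<n}"
      proof
        assume "G z \<in> vtx n ` {0..<n}"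
        then obtain j where j: "j < n" "G z = vtx n j" by auto
        then obtain k where "k < n" "g k = j"
          using bij unfolding bij_betw_def by (metis atLeastLessThan_iff imageE zero_le)
        then have "G z = G (vtx n k)" using G(2) j by simp
        then have "z = vtx n k" using Ginj by (simp add: inj_eq)
        with False \<open>k < n\<close> show False by simp
      qed
      moreover have "\<not> C v" if "v \<in> circle" "v \<notin> vtx n ` {0..<n}" for v
      proof -
        have "v \<notin> vtx n ` W" using that W by auto
        then have "C v = C0 v" using C that by simp
        then show ?thesis using that by (auto simp: C0_def)
      qed
      ultimately show ?thesis using False GC z by blast
    qed
    then have "\<forall>z\<in>circle. G z = z"
      using bspec[OF dist[unfolded distinguishing_def] G(1)] by blast
    then have "G (vtx n i) = vtx n i" by (rule bspec) (simp add: circle_iff)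
    then have "vtx n (g i) = vtx n i" using G(2)[of i] i by simp
    then show "g i = i" using i gn[of i] vtx_eq_iff[of "g i" n i] by simp
  qed
  ultimately show "\<exists>c. (\<forall>x\<in>{0..<n} - W. c x = c0 x) \<and> distinguishing {0..<n} (cycle_aut n) c"
    by blast
qed

section \<open>Upper bounds for the cycle\<close>

lemma eq_if_coprime_powers:
  fixes x q :: complex
  assumes "q \<noteq> 0" "x ^ a = q ^ a" "x ^ b = q ^ b" "coprime a b" "a > 0"
  shows "x = q"
proof -
  define t where "t = x / q"
  have t: "t ^ a = 1" "t ^ b = 1" using assms by (simp_all add: t_def power_divide)
  obtain u v where "a * u = b * v + 1"
    using bezout_nat[of a b] assms(4,5) by auto
  then have "t ^ (a * u) = t ^ (b * v) * t" by (simp add: power_add)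
  then have "t = 1" using t by (simp add: power_mult)
  then show ?thesis using assms(1) by (simp add: t_def)
qed

text \<open>A failing \<open>W\<close> lies in a coset of the fourth or fifth roots of unity and
  also among the \<open>n\<close>-th roots. Its size bound, 4 or 5, rules out \<open>4 dvd n\<close>
  or \<open>5 dvd n\<close> respectively; then the quotients are square roots of 1 or equal to 1,
  leaving at most two points.\<close>

lemma ext_good_cycle:
  assumes n: "n \<ge> 6"
  shows "ext_good {0..<n} (cycle_aut n) 6"
    and "\<not> 5 dvd n \<Longrightarrow> ext_good {0..<n} (cycle_aut n) 5"
    and "\<not> 4 dvd n \<Longrightarrow> \<not> 5 dvd n \<Longrightarrow> ext_good {0..<n} (cycle_aut n) 4"
proof -
  have good: "ext_good {0..<n} (cycle_aut n) m"
    if m: "4 \<le> m" "5 dvd n \<Longrightarrow> 6 \<le> m" "4 dvd n \<Longrightarrow> 5 \<le> m" for m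
    unfolding ext_good_def
  proof (intro allI impI)
    fix W assume W: "W \<subseteq> {0..<n}" "infinite W \<or> m \<le> card W"
    have cardW: "m \<le> card W" using W finite_subset by blast
    show "precol_ext {0..<n} (cycle_aut n) W"
    proof (rule ccontr)
      define V where "V = vtx n ` W"
      assume "\<not> precol_ext {0..<n} (cycle_aut n) W"
      then have no: "\<not> precol_ext circle O2 V"
        using precol_ext_cycle_if_circle[of n W] n W(1) by (auto simp: V_def)
      have "inj_on (vtx n) W" using inj_on_subset[OF inj_vtx W(1)] n by simp
      then have cardV: "m \<le> card V" using cardW by (simp add: V_def card_image)
      have Vcirc: "V \<subseteq> circle" by (auto simp: V_def circle_iff)
      have Vn: "x ^ n = 1" if "x \<in> V" for x using that n by (auto simp: V_def vtx_power_n)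
      have "V \<noteq> {}" using cardV m(1) by auto
      then obtain q where q: "q \<in> V" by blast
      have q0: "q \<noteq> 0" using q Vcirc by (auto simp: circle_iff)
      from powers_if_not_precol_ext[OF Vcirc no q] cardV m(1)
      consider (4) "\<forall>x\<in>V. x ^ 4 = q ^ 4" | (5) "\<forall>x\<in>V. x ^ 5 = q ^ 5" by linarith
      then show False
      proof cases
        case 4
        have "card V \<le> 4" using card_le_if_powers[OF 4 q0] by simp
        then have "\<not> 4 dvd n" using m(3) cardV by linarith
        \<comment> \<open>The order of \<open>x / q\<close> divides both 4 and \<open>n\<close>,
          hence divides 2 as 4 does not divide \<open>n\<close>.\<close>
        have "x ^ 2 = q ^ 2" if "x \<in> V" for x
        proof -
          define t where "t = x / q"
          have t4: "t ^ 4 = 1" using 4 that q0 by (simp add: t_def power_divide)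
          have tn: "t ^ n = 1" using Vn[OF that] Vn[OF q] by (simp add: t_def power_divide)
          have "t ^ n = t ^ (4 * (n div 4) + n mod 4)" by simp
          also have "\<dots> = t ^ (n mod 4)" unfolding power_add power_mult t4 by simp
          finally have tr: "t ^ (n mod 4) = 1" using tn by simp
          have "n mod 4 = 1 \<or> n mod 4 = 2 \<or> n mod 4 = 3"
            using \<open>\<not> 4 dvd n\<close> by presburger
          then have "t ^ 2 = 1"
          proof (elim disjE)
            assume "n mod 4 = 3"
            then have "t ^ 3 = 1" using tr by simp
            moreover have "t ^ 4 = t ^ 3 * t" by (simp add: eval_nat_numeral)
            ultimately have "t = 1" using t4 by simp
            then show ?thesis by simp
          qed (use tr in simp_all)
          then show ?thesis using q0 by (simp add: t_def power_divide)
        qed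
        then have "card V \<le> 2" using card_le_if_powers(2)[of V 2 q] q0 by simp
        then show False using cardV m(1) by simp
      next
        case 5
        have "card V \<le> 5" using card_le_if_powers[OF 5 q0] by simp
        then have "\<not> 5 dvd n" using m(2) cardV by linarith
        then have "coprime 5 n" by (intro prime_imp_coprime) simp_all
        then have "x = q" if "x \<in> V" for x
          using eq_if_coprime_powers[of q x 5 n] 5 that q0 Vn[OF that] Vn[OF q] by simp
        then have "V \<subseteq> {q}" by blast
        then have "card V \<le> 1" using card_mono[of "{q}" V] by simp
        then show False using cardV m(1) by simp
      qed
    qed
  qed
  show "ext_good {0..<n} (cycle_aut n) 6" by (rule good) simp_all
  show "ext_good {0..<n} (cycle_aut n) 5" if "\<not> 5 dvd n" using that by (intro good) simp_all
  show "ext_good {0..<n} (cycle_aut n) 4" if "\<not> 4 dvd n" "\<not> 5 dvd n" using that by (intro good) simp_all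
qed

subsection \<open>Lower bounds\<close>

text \<open>A single failing \<open>W\<close> of size \<open>m\<close> refutes every bound up to
  \<open>m\<close>.\<close>

lemma extD_eqI:
  assumes good: "ext_good X G (Suc m)"
    and W: "W \<subseteq> X" "finite W" "card W = m" "trivial_pointwise_stab X G W" "\<not> precol_ext X G W"
  shows "extD X G = enat (Suc m)"
proof -
  have "Suc m \<le> k" if "ext_good X G k" for k
  proof (rule ccontr)
    assume "\<not> Suc m \<le> k"
    then have "k \<le> card W" using W(3) by simp
    with that W show False unfolding ext_good_def by blast
  qed
  then show ?thesis
    unfolding extD_def using good by (intro antisym Inf_lower Inf_greatest) auto
qed

text \<open>The reflection \<open>i \<mapsto> a - i\<close> modulo \<open>n\<close>; the inner subtraction is exact only for \<open>i \<le> n\<close>.\<close>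

definition cycle_refl :: "nat \<Rightarrow> nat \<Rightarrow> nat \<Rightarrow> nat" where
  "cycle_refl n a i = (a + (n - i)) mod n"

lemma cycle_refl_less: "n > 0 \<Longrightarrow> cycle_refl n a i < n"
  by (simp add: cycle_refl_def)

lemma vtx_cycle_refl:
  assumes "i < n"
  shows "vtx n (cycle_refl n a i) * vtx n i = vtx n a"
proof -
  have "vtx n (cycle_refl n a i) = vtx n (a + (n - i))"
    unfolding cycle_refl_def using assms by (intro vtx_mod) simp
  then have "vtx n (cycle_refl n a i) * vtx n i = vtx n (a + (n - i) + i)"
    by (simp only: vtx_add)
  also have "a + (n - i) + i = a + n" using assms by simp
  also have "vtx n (a + n) = vtx n a" using assms by (simp add: vtx_add vtx_n)
  finally show ?thesis .
qed

lemma cycle_refl_cycle_refl: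
  assumes "i < n"
  shows "cycle_refl n a (cycle_refl n a i) = i"
proof -
  have l: "cycle_refl n a j < n" for j using assms by (simp add: cycle_refl_less)
  have "vtx n (cycle_refl n a (cycle_refl n a i)) * vtx n (cycle_refl n a i) = vtx n i * vtx n (cycle_refl n a i)"
    using vtx_cycle_refl[OF l[of i], of a] vtx_cycle_refl[OF assms, of a] by (metis mult.commute)
  then have "vtx n (cycle_refl n a (cycle_refl n a i)) = vtx n i" by simp
  then show ?thesis using vtx_eq_iff[OF l assms] by blast
qed

lemma cycle_adj_iff_vtx:
  assumes "i < n" "j < n" "n \<ge> 2"
  shows "cycle_adj n i j \<longleftrightarrow> vtx n j = vtx n i * vtx n 1 \<or> vtx n i = vtx n j * vtx n 1"
proof -
  have *: "k = Suc l mod n \<longleftrightarrow> vtx n k = vtx n l * vtx n 1" if "k < n" for k l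
    using vtx_eq_iff[of k n "Suc l mod n"] that vtx_add[of n l 1] by (simp add: vtx_mod)
  have "Suc k mod n \<noteq> k" if "k < n" for k using that assms(3) by (simp add: mod_Suc)
  then show ?thesis
    unfolding cycle_adj_def *[OF assms(1), symmetric] *[OF assms(2), symmetric] using assms by metis
qed

lemma cycle_refl_in_cycle_aut:
  assumes "n \<ge> 2"
  shows "cycle_refl n a \<in> cycle_aut n"
proof -
  have l: "cycle_refl n a i < n" for i using assms by (simp add: cycle_refl_less)
  have "bij_betw (cycle_refl n a) {0..<n} {0..<n}"
    by (rule bij_betw_byWitness[where f' = "cycle_refl n a"]) (auto simp: cycle_refl_cycle_refl l)
  moreover have "cycle_adj n i j \<longleftrightarrow> cycle_adj n (cycle_refl n a i) (cycle_refl n a j)"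
    if ij: "i < n" "j < n" for i j
  proof -
    \<comment> \<open>Reflections invert quotients of vertices, which exchanges the two disjuncts of
      adjacency.\<close>
    have swap: "u / y = u / x * v \<longleftrightarrow> x = y * v" if "u \<noteq> 0" "x \<noteq> 0" "y \<noteq> 0" for u v x y :: complex
      using that by (auto simp: field_simps)
    have "vtx n (cycle_refl n a i) = vtx n a / vtx n i" if "i < n" for i
      using vtx_cycle_refl[OF that, of a] by (simp add: nonzero_eq_divide_eq)
    from this[OF ij(1)] this[OF ij(2)] show ?thesis
      unfolding cycle_adj_iff_vtx[OF ij assms] cycle_adj_iff_vtx[OF l l assms]
      by (simp only: swap[OF vtx_nonzero vtx_nonzero vtx_nonzero] disj_commute)
  qed
  ultimately show ?thesis by (simp add: cycle_aut_def)
qed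

text \<open>Colour everything outside \<open>W\<close> with \<open>False\<close>: an extension is
  then the indicator function of some \<open>D \<subseteq> W\<close>. Mapping \<open>D\<close> into
  itself is enough for invariance, because a reflection is its own inverse.\<close>

lemma not_precol_ext_if_reflections:
  assumes n: "n \<ge> 3" and W: "W \<subseteq> {0..<n}"
    and refl: "\<And>D. D \<subseteq> W \<Longrightarrow> \<exists>a. \<forall>i\<in>D. cycle_refl n a i \<in> D"
  shows "\<not> precol_ext {0..<n} (cycle_aut n) W"
proof
  assume "precol_ext {0..<n} (cycle_aut n) W"
  from spec[OF this[unfolded precol_ext_def], of "\<lambda>_. False"]
  obtain c where c: "\<forall>x\<in>{0..<n} - W. c x = False" and dist: "distinguishing {0..<n} (cycle_aut n) c"
    by blast
  define D where "D = {i\<in>{0..<n}. c i}"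
  have "D \<subseteq> W" using c by (auto simp: D_def)
  then obtain a where a: "\<forall>i\<in>D. cycle_refl n a i \<in> D" using refl by blast
  have l: "cycle_refl n a i < n" for i using n by (simp add: cycle_refl_less)
  have "c (cycle_refl n a i) = c i" if "i < n" for i
  proof
    show "c i \<Longrightarrow> c (cycle_refl n a i)" using a that by (auto simp: D_def)
    show "c (cycle_refl n a i) \<Longrightarrow> c i"
      using a l[of i] cycle_refl_cycle_refl[OF that, of a] by (auto simp: D_def)
  qed
  then have "\<forall>x\<in>{0..<n}. c (cycle_refl n a x) = c x" by simp
  moreover have "cycle_refl n a \<in> cycle_aut n" using n by (intro cycle_refl_in_cycle_aut) simp
  ultimately have id: "\<forall>x\<in>{0..<n}. cycle_refl n a x = x"
    using dist unfolding distinguishing_def by blast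
  \<comment> \<open>Fixing 0 and 1 means that \<open>a\<close> is congruent to both 0 and 2,
    impossible for \<open>n \<ge> 3\<close>.\<close>
  have "cycle_refl n a 0 = 0" "cycle_refl n a 1 = 1" using id n by simp_all
  then have "vtx n a = 1" "vtx n 1 * vtx n 1 = vtx n a"
    using vtx_cycle_refl[of 0 n a] vtx_cycle_refl[of 1 n a] n by simp_all
  then have "vtx n (1 + 1) = 1" by (simp only: vtx_add)
  then have "n dvd 2" using vtx_eq_1_iff[of n "1 + 1"] n by (simp add: numeral_2_eq_2)
  then show False using n dvd_imp_le[of n 2] by simp
qed

lemma cnj_vtx_neq:
  assumes "n > 0" "\<not> n dvd 2 * j"
  shows "cnj (vtx n j) \<noteq> vtx n j"
proof
  assume "cnj (vtx n j) = vtx n j"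
  then have "vtx n j * vtx n j = vtx n j * cnj (vtx n j)" by simp
  also have "\<dots> = 1" by (simp add: complex_norm_square[symmetric])
  finally have "vtx n (j + j) = 1" by (simp add: vtx_add)
  then show False using assms vtx_eq_1_iff[of n "j + j"] by (simp add: mult_2)
qed

text \<open>Apart from the identity, only the reflection corresponding to \<open>cnj\<close> fixes
  the vertex 0, and it moves \<open>j\<close> unless \<open>n dvd 2 * j\<close>.\<close>

lemma trivial_stab_cycle:
  assumes n: "n \<ge> 3" and W: "0 \<in> W" "j \<in> W" "j < n" "\<not> n dvd 2 * j"
  shows "trivial_pointwise_stab {0..<n} (cycle_aut n) W"
  unfolding trivial_pointwise_stab_def
proof (intro ballI impI)
  fix g i
  assume g: "g \<in> cycle_aut n" and fixW: "\<forall>w\<in>W. g w = w" and i: "i \<in> {0..<n}"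
  have g0: "g 0 = 0" "g j = j" using fixW W by simp_all
  have gi: "g i < n" using g i bij_betwE[of g "{0..<n}" "{0..<n}"] by (auto simp: cycle_aut_def)
  show "g i = i"
  proof (cases rule: cycle_aut_vtx[OF n g])
    case 1
    have "vtx n (g i) = vtx n i" using 1[of i] i by (simp add: g0)
    then show ?thesis using vtx_eq_iff[OF gi, of i] i by simp
  next
    case 2
    have "vtx n j = cnj (vtx n j)" using 2[OF W(3)] by (simp add: g0)
    then show ?thesis using cnj_vtx_neq[of n j] n W(4) by simp
  qed
qed

lemma trivial_stab_circle:
  assumes n: "n > 0" and W: "1 \<in> W" "vtx n j \<in> W" "\<not> n dvd 2 * j"
  shows "trivial_pointwise_stab circle O2 W"
  unfolding trivial_pointwise_stab_def
proof (intro ballI impI)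
  fix g z
  assume g: "g \<in> O2" and fixW: "\<forall>w\<in>W. g w = w"
  have g1: "g 1 = 1" "g (vtx n j) = vtx n j" using fixW W by simp_all
  from g show "g z = z"
  proof (cases rule: O2_cases)
    case (1 \<alpha>)
    then show ?thesis using g1 by simp
  next
    case (2 \<alpha>)
    then have "cnj (vtx n j) = vtx n j" using g1 by simp
    then show ?thesis using cnj_vtx_neq[OF n W(3)] by simp
  qed
qed

section \<open>Sets that violate the extension property\<close>

lemma not_precol_ext_012:
  assumes n: "n \<ge> 6"
  shows "\<not> precol_ext {0..<n} (cycle_aut n) {0, 1, 2}"
proof (rule not_precol_ext_if_reflections)
  fix D :: "nat set" assume D: "D \<subseteq> {0, 1, 2}"
  \<comment> \<open>The largest parameter used below is 4 = 2 + 2; as \<open>n \<ge> 6\<close>, the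
    value \<open>a - i\<close> needs no reduction.\<close>
  have r: "cycle_refl n a i = a - i" if "i \<le> a" "a \<le> 4" for a i
  proof -
    have e: "a + (n - i) = (a - i) + n" using that n by linarith
    show ?thesis unfolding cycle_refl_def e mod_add_self2 using that n by (intro mod_less) linarith
  qed
  have r': "cycle_refl n 0 0 = 0" "cycle_refl n 1 0 = 1" "cycle_refl n 1 1 = 0"
    "cycle_refl n 2 0 = 2" "cycle_refl n 2 1 = 1" "cycle_refl n 2 2 = 0"
    "cycle_refl n 3 1 = 2" "cycle_refl n 3 2 = 1" "cycle_refl n 4 2 = 2"
    by (simp_all add: r)
  have D': "i = 0 \<or> i = 1 \<or> i = 2" if "i \<in> D" for i using that D by auto
  \<comment> \<open>The parameter is the sum of the two ends of \<open>D\<close>: 0 + 2 (which also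
    serves {1} and the empty set), 0 + 1, 0 + 0, 1 + 2 and 2 + 2.\<close>
  consider "0 \<in> D \<longleftrightarrow> 2 \<in> D" | "2 \<notin> D" "1 \<in> D" "0 \<in> D" | "2 \<notin> D" "1 \<notin> D" "0 \<in> D"
    | "2 \<in> D" "1 \<in> D" "0 \<notin> D" | "2 \<in> D" "1 \<notin> D" "0 \<notin> D"
    by blast
  then show "\<exists>a. \<forall>i\<in>D. cycle_refl n a i \<in> D"
  proof cases
    case 1
    then have "\<forall>i\<in>D. cycle_refl n 2 i \<in> D" using r' D' by metis
    then show ?thesis by blast
  next
    case 2
    then have "\<forall>i\<in>D. cycle_refl n 1 i \<in> D" using r' D' by metis
    then show ?thesis by blast
  next
    case 3
    then have "\<forall>i\<in>D. cycle_refl n 0 i \<in> D" using r' D' by metis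
    then show ?thesis by blast
  next
    case 4
    then have "\<forall>i\<in>D. cycle_refl n 3 i \<in> D" using r' D' by metis
    then show ?thesis by blast
  next
    case 5
    then have "\<forall>i\<in>D. cycle_refl n 4 i \<in> D" using r' D' by metis
    then show ?thesis by blast
  qed
qed (use n in auto)

text \<open>Multiplication by \<open>m\<close> places the \<open>k\<close>-cycle as a regular
  \<open>k\<close>-gon and turns the reflection with parameter \<open>a\<close> into the one with
  \<open>a * m\<close>.\<close>

lemma not_precol_ext_multiples:
  assumes k: "k \<ge> 3" and m: "m > 0"
    and refl: "\<And>D. D \<subseteq> {0..<k} \<Longrightarrow> \<exists>a. \<forall>i\<in>D. cycle_refl k a i \<in> D"
  shows "\<not> precol_ext {0..<k * m} (cycle_aut (k * m)) ((\<lambda>i. i * m) ` {0..<k})"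
proof (rule not_precol_ext_if_reflections)
  have "k * 1 \<le> k * m" using m by (intro mult_le_mono) auto
  then show "3 \<le> k * m" using k by linarith
  show "(\<lambda>i. i * m) ` {0..<k} \<subseteq> {0..<k * m}" using m by auto
  fix D assume "D \<subseteq> (\<lambda>i. i * m) ` {0..<k}"
  then obtain D' where D': "D' \<subseteq> {0..<k}" "D = (\<lambda>i. i * m) ` D'" by (auto simp: subset_image_iff)
  then obtain a where a: "\<forall>i\<in>D'. cycle_refl k a i \<in> D'" using refl by blast
  have "cycle_refl (k * m) (a * m) (i * m) = cycle_refl k a i * m" for i
  proof -
    have "a * m + (k * m - i * m) = (a + (k - i)) * m" by (simp add: add_mult_distrib diff_mult_distrib)
    then show ?thesis unfolding cycle_refl_def by (metis mod_mult_mult2)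
  qed
  then have "\<forall>i\<in>D. cycle_refl (k * m) (a * m) i \<in> D" using a D' by auto
  then show "\<exists>a. \<forall>i\<in>D. cycle_refl (k * m) a i \<in> D" by blast
qed

text \<open>If neither diagonal is an axis, \<open>D\<close> has exactly one vertex of each opposite
  pair. It then consists of two neighbours, which are swapped by parameter 1 or 3.\<close>

lemma square_reflections:
  fixes D :: "nat set"
  assumes D: "D \<subseteq> {0..<4}"
  shows "\<exists>a. \<forall>i\<in>D. cycle_refl 4 a i \<in> D"
proof -
  have vals: "cycle_refl 4 0 0 = 0" "cycle_refl 4 0 1 = 3" "cycle_refl 4 0 2 = 2" "cycle_refl 4 0 3 = 1"
    "cycle_refl 4 1 0 = 1" "cycle_refl 4 1 1 = 0" "cycle_refl 4 1 2 = 3" "cycle_refl 4 1 3 = 2"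
    "cycle_refl 4 2 0 = 2" "cycle_refl 4 2 1 = 1" "cycle_refl 4 2 2 = 0" "cycle_refl 4 2 3 = 3"
    "cycle_refl 4 3 0 = 3" "cycle_refl 4 3 1 = 2" "cycle_refl 4 3 2 = 1" "cycle_refl 4 3 3 = 0"
    by (simp_all add: cycle_refl_def)
  have D': "i = 0 \<or> i = 1 \<or> i = 2 \<or> i = 3" if "i \<in> D" for i using that D by auto
  consider "1 \<in> D \<longleftrightarrow> 3 \<in> D"
    | "0 \<in> D \<longleftrightarrow> 1 \<in> D" "2 \<in> D \<longleftrightarrow> 3 \<in> D"
    | "0 \<in> D \<longleftrightarrow> 2 \<in> D"
    | "0 \<in> D \<longleftrightarrow> 3 \<in> D" "1 \<in> D \<longleftrightarrow> 2 \<in> D"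
    by blast
  then show ?thesis
  proof cases
    case 1
    then have "\<forall>i\<in>D. cycle_refl 4 0 i \<in> D" using vals D' by metis
    then show ?thesis by blast
  next
    case 2
    then have "\<forall>i\<in>D. cycle_refl 4 1 i \<in> D" using vals D' by metis
    then show ?thesis by blast
  next
    case 3
    then have "\<forall>i\<in>D. cycle_refl 4 2 i \<in> D" using vals D' by metis
    then show ?thesis by blast
  next
    case 4
    then have "\<forall>i\<in>D. cycle_refl 4 3 i \<in> D" using vals D' by metis
    then show ?thesis by blast
  qed
qed

text \<open>\<open>D\<close> or its complement has at most two vertices; a vertex \<open>i\<close>
  has the axis with parameter 2i, and a pair has the axis whose parameter is its sum modulo 5. The
  cases list the two pairs swapped by each parameter.\<close>

lemma pentagon_reflections:
  fixes D :: "nat set"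
  assumes D: "D \<subseteq> {0..<5}"
  shows "\<exists>a. \<forall>i\<in>D. cycle_refl 5 a i \<in> D"
proof -
  have vals: "cycle_refl 5 0 0 = 0" "cycle_refl 5 0 1 = 4" "cycle_refl 5 0 2 = 3" "cycle_refl 5 0 3 = 2" "cycle_refl 5 0 4 = 1"
    "cycle_refl 5 1 0 = 1" "cycle_refl 5 1 1 = 0" "cycle_refl 5 1 2 = 4" "cycle_refl 5 1 3 = 3" "cycle_refl 5 1 4 = 2"
    "cycle_refl 5 2 0 = 2" "cycle_refl 5 2 1 = 1" "cycle_refl 5 2 2 = 0" "cycle_refl 5 2 3 = 4" "cycle_refl 5 2 4 = 3"
    "cycle_refl 5 3 0 = 3" "cycle_refl 5 3 1 = 2" "cycle_refl 5 3 2 = 1" "cycle_refl 5 3 3 = 0" "cycle_refl 5 3 4 = 4"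
    "cycle_refl 5 4 0 = 4" "cycle_refl 5 4 1 = 3" "cycle_refl 5 4 2 = 2" "cycle_refl 5 4 3 = 1" "cycle_refl 5 4 4 = 0"
    by (simp_all add: cycle_refl_def)
  have D': "i = 0 \<or> i = 1 \<or> i = 2 \<or> i = 3 \<or> i = 4" if "i \<in> D" for i using that D by auto
  consider "1 \<in> D \<longleftrightarrow> 4 \<in> D" "2 \<in> D \<longleftrightarrow> 3 \<in> D"
    | "0 \<in> D \<longleftrightarrow> 1 \<in> D" "2 \<in> D \<longleftrightarrow> 4 \<in> D"
    | "0 \<in> D \<longleftrightarrow> 2 \<in> D" "3 \<in> D \<longleftrightarrow> 4 \<in> D"
    | "0 \<in> D \<longleftrightarrow> 3 \<in> D" "1 \<in> D \<longleftrightarrow> 2 \<in> D"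
    | "0 \<in> D \<longleftrightarrow> 4 \<in> D" "1 \<in> D \<longleftrightarrow> 3 \<in> D"
    by blast
  then show ?thesis
  proof cases
    case 1
    then have "\<forall>i\<in>D. cycle_refl 5 0 i \<in> D" using vals D' by metis
    then show ?thesis by blast
  next
    case 2
    then have "\<forall>i\<in>D. cycle_refl 5 1 i \<in> D" using vals D' by metis
    then show ?thesis by blast
  next
    case 3
    then have "\<forall>i\<in>D. cycle_refl 5 2 i \<in> D" using vals D' by metis
    then show ?thesis by blast
  next
    case 4
    then have "\<forall>i\<in>D. cycle_refl 5 3 i \<in> D" using vals D' by metis
    then show ?thesis by blast
  next
    case 5
    then have "\<forall>i\<in>D. cycle_refl 5 4 i \<in> D" using vals D' by metis
    then show ?thesis by blast
  qed
qed

lemma regular_polygon: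
  fixes k m :: nat
  assumes k: "k \<ge> 3" and m: "m > 0"
  shows "(\<lambda>i. i * m) ` {0..<k} \<subseteq> {0..<k * m}" "card ((\<lambda>i. i * m) ` {0..<k}) = k"
    "trivial_pointwise_stab {0..<k * m} (cycle_aut (k * m)) ((\<lambda>i. i * m) ` {0..<k})"
proof -
  show "(\<lambda>i. i * m) ` {0..<k} \<subseteq> {0..<k * m}" using m by auto
  show "card ((\<lambda>i. i * m) ` {0..<k}) = k" using m by (simp add: card_image inj_on_def)
  show "trivial_pointwise_stab {0..<k * m} (cycle_aut (k * m)) ((\<lambda>i. i * m) ` {0..<k})"
  proof (rule trivial_stab_cycle)
    have "k * 1 \<le> k * m" using m by (intro mult_le_mono) auto
    then show "3 \<le> k * m" using k by linarith
    show "0 \<in> (\<lambda>i. i * m) ` {0..<k}" using k by (intro image_eqI[where x = 0]) auto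
    show "m \<in> (\<lambda>i. i * m) ` {0..<k}" using k by (intro image_eqI[where x = 1]) auto
    show "m < k * m" using k m by simp
    show "\<not> k * m dvd 2 * m" using k m by (auto dest: dvd_imp_le)
  qed
qed

theorem theorem1:
  shows "(\<forall>n::nat. n \<ge> 6 \<longrightarrow>
            ((\<not> 4 dvd n \<and> \<not> 5 dvd n \<longrightarrow> extD_cycle n = 4) \<and>
             (4 dvd n \<and> \<not> 5 dvd n \<longrightarrow> extD_cycle n = 5) \<and>
             (5 dvd n \<longrightarrow> extD_cycle n = 6)))
         \<and> extD circle O2 = 6"
proof (intro conjI allI impI)
  fix n :: nat assume n: "n \<ge> 6"
  show "extD_cycle n = 4" if "\<not> 4 dvd n \<and> \<not> 5 dvd n"
  proof -
    have "trivial_pointwise_stab {0..<n} (cycle_aut n) {0, 1, 2}"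
      by (rule trivial_stab_cycle[where j = 1]) (use n in \<open>auto dest: dvd_imp_le\<close>)
    moreover have "ext_good {0..<n} (cycle_aut n) (Suc 3)"
      using ext_good_cycle(3)[OF n] that by simp
    ultimately have "extD_cycle n = enat (Suc 3)"
      unfolding extD_cycle_def using n not_precol_ext_012[OF n]
      by (intro extD_eqI[where W = "{0, 1, 2}"]) auto
    then show ?thesis by (simp add: numeral_eq_enat)
  qed
  show "extD_cycle n = 5" if d: "4 dvd n \<and> \<not> 5 dvd n"
  proof -
    obtain m where m: "n = 4 * m" using d by blast
    have "m > 0" using m n by simp
    have "ext_good {0..<n} (cycle_aut n) (Suc 4)"
      using ext_good_cycle(2)[OF n] d by simp
    then have "extD_cycle n = enat (Suc 4)"
      unfolding extD_cycle_def m
      using regular_polygon[of 4 m] not_precol_ext_multiples[of 4 m] square_reflections \<open>m > 0\<close>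
      by (intro extD_eqI[where W = "(\<lambda>i. i * m) ` {0..<4}"]) simp_all
    then show ?thesis by (simp add: numeral_eq_enat)
  qed
  show "extD_cycle n = 6" if d: "5 dvd n"
  proof -
    obtain m where m: "n = 5 * m" using d by blast
    have "m > 0" using m n by simp
    have "ext_good {0..<n} (cycle_aut n) (Suc 5)"
      using ext_good_cycle(1)[OF n] by simp
    then have "extD_cycle n = enat (Suc 5)"
      unfolding extD_cycle_def m
      using regular_polygon[of 5 m] not_precol_ext_multiples[of 5 m] pentagon_reflections \<open>m > 0\<close>
      by (intro extD_eqI[where W = "(\<lambda>i. i * m) ` {0..<5}"]) simp_all
    then show ?thesis by (simp add: numeral_eq_enat)
  qed
next
  \<comment> \<open>The full vertex set fails on the 5-cycle, so by
    \<open>precol_ext_cycle_if_circle\<close> the regular pentagon fails on the circle.\<close>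
  define W where "W = vtx 5 ` {0..<5}"
  have "\<not> precol_ext circle O2 W"
    using precol_ext_cycle_if_circle[of 5 "{0..<5}"] not_precol_ext_multiples[of 5 1] pentagon_reflections
    by (auto simp: W_def)
  moreover have "trivial_pointwise_stab circle O2 W"
  proof (rule trivial_stab_circle[of 5])
    show "1 \<in> W" unfolding W_def by (rule image_eqI[where x = 0]) simp_all
    show "vtx 5 1 \<in> W" unfolding W_def by (rule image_eqI[where x = 1]) simp_all
  qed simp_all
  moreover have "card W = 5" unfolding W_def using inj_vtx[of 5] by (simp add: card_image)
  moreover have "W \<subseteq> circle" "finite W" by (auto simp: W_def circle_iff)
  moreover have "ext_good circle O2 (Suc 5)" using ext_good_circle by simp
  ultimately have "extD circle O2 = enat (Suc 5)" by (intro extD_eqI)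
  then show "extD circle O2 = 6" by (simp add: numeral_eq_enat)
qed

end
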